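(* Let $\nu>0$, $\lambda>0$, let $F\in C(\mathbb R,\mathbb R)$ be Lipschitz continuous on bounded sets with $F(0)=0$, and assume that $F(s)s\le 0$ for all $s\in\mathbb R$. Let $\mathfrak f=(f_i)_{i\in\mathbb Z}\in C(\mathbb R,\ell_2)$ be Lagrange stable and let $\mathfrak f^n:=P_n(\mathfrak f)=(f_i)_{|i|\le n}$ for $n\in\mathbb N$. Let $\{I_{\mathfrak g}\mid \mathfrak g\in H(\mathfrak f)\}$ be the compact global attractor of the cocycle $\varphi$ generated on $\ell_2$ by the lattice system with forcing $\mathfrak f$, and for each $n$ let $\{I^n_{\widetilde{\mathfrak g}}\mid \widetilde{\mathfrak g}\in H(\mathfrak f^n)\}$ be the compact global attractor of the cocycle $\varphi_n$ generated on $\mathbb R^{2n+1}$ by the $(2n+1)$-dimensional periodic approximation with forcing $\mathfrak f^n$. Then, regarding $I^n_{\mathfrak f^n}$ as a subset of $\ell_2$, $$\lim_{n\to\infty}\beta\big(I^n_{\mathfrak f^n},I_{\mathfrak f}\big)=0 .$$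
   Context: Spaces. $\ell_2$ is the Hilbert space of two-sided real square-summable sequences $(\xi_i)_{i\in\mathbb Z}$. For a Banach space $\mathfrak B$, $C(\mathbb R,\mathfrak B)$ carries the compact-open topology (uniform convergence on compact intervals). $\sigma(h,\mathfrak f)=\mathfrak f^{(h)}$, $\mathfrak f^{(h)}(t)=\mathfrak f(t+h)$, is the shift dynamical system on it; $H(\mathfrak f)$ is the closure of $\{\mathfrak f^{(h)}\mid h\in\mathbb R\}$ in $C(\mathbb R,\mathfrak B)$; $\mathfrak f$ is Lagrange stable if $H(\mathfrak f)$ is compact. $\mathbb R^{2n+1}$ (coordinates indexed by $|i|\le n$, Euclidean norm) is identified with a subspace of $\ell_2$ by extending vectors by zero for $|i|>n$. For subsets $A,B$ of a metric space, $\beta(A,B)=\sup_{a\in A}\inf_{b\in B}d(a,b)$ is the Hausdorff semi-distance. Lattice cocycle. For $\mathfrak g\in H(\mathfrak f)$ and $v\in\ell_2$, $\varphi(t,v,\mathfrak g)$, $t\ge 0$, is the solution with $u(0)=v$ of $u_i'=\nu(u_{i-1}-2u_i+u_{i+1})-\lambda u_i+F(u_i)+g_i(t)$, $i\in\mathbb Z$, in $\ell_2$. Approximating cocycle. For $n\in\mathbb N$, $\widetilde{\mathfrak g}\in H(\mathfrak f^n)\subset C(\mathbb R,\mathbb R^{2n+1})$ and $v\in\mathbb R^{2n+1}$, $\varphi_n(t,v,\widetilde{\mathfrak g})$, $t\ge0$, is the solution with value $v$ at $t=0$ of $\dot v_i=\nu(v_{i-1}-2v_i+v_{i+1})-\lambda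 v_i+F(v_i)+\widetilde g_i(t)$, $|i|\le n$, with the periodic convention $v_{n+1}:=v_{-n}$, $v_{-n-1}:=v_n$. Attractor. Let $Y$ be a compact metric space with a dynamical system $(Y,\mathbb R,\sigma)$, and $\phi:\mathbb R_+\times W\times Y\to W$ a cocycle over it with complete metric fibre $W$ (i.e. $\phi$ is continuous, $\phi(0,u,y)=u$, $\phi(t+\tau,u,y)=\phi(\tau,\phi(t,u,y),\sigma(t,y))$). $\phi$ is uniformly compactly dissipative if there is a nonempty compact $K\subseteq W$ with $\lim_{t\to+\infty}\sup_{y\in Y}\beta(\phi(t,M,y),K)=0$ for every compact $M\subseteq W$. Its compact global attractor (Levinson center) is then the family $\{I_y\mid y\in Y\}$, $I_y=\bigcap_{t\ge0}\overline{\bigcup_{\tau\ge t}\phi(\tau,K,\sigma(-\tau,y))}$, which does not depend on the choice of $K$. The cocycles $\varphi$ (over $H(\mathfrak f)$) and $\varphi_n$ (over $H(\mathfrak f^n)$) are uniformly compactly dissipative, so these attractors are defined. *)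

theory Defs
  imports "HOL-Analysis.Analysis"
begin

section \<open>The Hilbert space of two-sided square-summable real sequences\<close>

typedef ell2 = "{x :: int \<Rightarrow> real. (\<lambda>i. (x i)\<^sup>2) summable_on UNIV}"
  morphisms coord Abs_ell2
  by (rule exI[of _ "\<lambda>_. 0"]) simp

setup_lifting type_definition_ell2

lemma coord_square_summable: "(\<lambda>i. (coord x i)\<^sup>2) summable_on UNIV"
  using coord[of x] by simp

lemma ell2_eqI: "(\<And>i. coord x i = coord y i) \<Longrightarrow> x = y"
  by (metis coord_inject ext)

lemma square_summable_add:
  fixes x y :: "int \<Rightarrow> real"
  assumes "(\<lambda>i. (x i)\<^sup>2) summable_on UNIV" "(\<lambda>i. (y i)\<^sup>2) summable_on UNIV"
  shows "(\<lambda>i. (x i + y i)\<^sup>2) summable_on UNIV"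
proof (rule summable_on_comparison_test)
  show "(\<lambda>i. 2 * (x i)\<^sup>2 + 2 * (y i)\<^sup>2) summable_on UNIV"
    by (intro summable_on_add summable_on_cmult_right assms)
  show "(x i + y i)\<^sup>2 \<le> 2 * (x i)\<^sup>2 + 2 * (y i)\<^sup>2" for i
    using zero_le_power2[of "x i - y i"] by (simp add: power2_eq_square algebra_simps)
qed simp

lemma square_summable_scale:
  fixes x :: "int \<Rightarrow> real"
  assumes "(\<lambda>i. (x i)\<^sup>2) summable_on UNIV"
  shows "(\<lambda>i. (c * x i)\<^sup>2) summable_on UNIV"
  using summable_on_cmult_right[OF assms, of "c\<^sup>2"] by (simp add: power_mult_distrib)

lemma coord_mult_summable: "(\<lambda>i. coord x i * coord y i) summable_on UNIV"
proof -
  have "(\<lambda>i. norm (coord x i * coord y i)) summable_on UNIV"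
  proof (rule summable_on_comparison_test)
    show "(\<lambda>i. (coord x i)\<^sup>2 + (coord y i)\<^sup>2) summable_on UNIV"
      by (intro summable_on_add coord_square_summable)
    show "norm (coord x i * coord y i) \<le> (coord x i)\<^sup>2 + (coord y i)\<^sup>2" for i
    proof -
      have "2 * (\<bar>coord x i\<bar> * \<bar>coord y i\<bar>) \<le> (coord x i)\<^sup>2 + (coord y i)\<^sup>2"
        using zero_le_power2[of "\<bar>coord x i\<bar> - \<bar>coord y i\<bar>"]
        by (simp add: power2_diff algebra_simps)
      moreover have "0 \<le> \<bar>coord x i\<bar> * \<bar>coord y i\<bar>" by simp
      ultimately show ?thesis unfolding real_norm_def abs_mult by linarith
    qed
  qed simp
  then show ?thesis by (rule abs_summable_summable)
qed

instantiation ell2 :: real_vector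
begin

lift_definition zero_ell2 :: ell2 is "\<lambda>_. 0" by simp
lift_definition plus_ell2 :: "ell2 \<Rightarrow> ell2 \<Rightarrow> ell2" is "\<lambda>x y i. x i + y i"
  by (rule square_summable_add)
lift_definition uminus_ell2 :: "ell2 \<Rightarrow> ell2" is "\<lambda>x i. - x i" by simp
lift_definition minus_ell2 :: "ell2 \<Rightarrow> ell2 \<Rightarrow> ell2" is "\<lambda>x y i. x i - y i"
  subgoal for x y using square_summable_add[of x "\<lambda>i. - y i"] by simp
  done
lift_definition scaleR_ell2 :: "real \<Rightarrow> ell2 \<Rightarrow> ell2" is "\<lambda>c x i. c * x i"
  by (rule square_summable_scale)

instance
  by standard (transfer; auto simp: algebra_simps)+

end

lemmas coord_simps [simp] =
  zero_ell2.rep_eq plus_ell2.rep_eq uminus_ell2.rep_eq minus_ell2.rep_eq scaleR_ell2.rep_eq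

instantiation ell2 :: real_inner
begin

definition inner_ell2 :: "ell2 \<Rightarrow> ell2 \<Rightarrow> real" where
  "inner_ell2 x y = (\<Sum>\<^sub>\<infinity>i. coord x i * coord y i)"
definition norm_ell2 :: "ell2 \<Rightarrow> real" where
  "norm_ell2 x = sqrt (inner x x)"
definition dist_ell2 :: "ell2 \<Rightarrow> ell2 \<Rightarrow> real" where
  "dist_ell2 x y = norm (x - y)"
definition sgn_ell2 :: "ell2 \<Rightarrow> ell2" where
  "sgn_ell2 x = x /\<^sub>R norm x"
definition uniformity_ell2 :: "(ell2 \<times> ell2) filter" where
  "uniformity_ell2 = (INF e\<in>{0<..}. principal {(x, y). dist x y < e})"
definition open_ell2 :: "ell2 set \<Rightarrow> bool" where
  "open_ell2 U \<longleftrightarrow> (\<forall>x\<in>U. eventually (\<lambda>(x', y). x' = x \<longrightarrow> y \<in> U) uniformity)"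

instance
proof
  fix x y z :: ell2 and r :: real
  show "inner x y = inner y x"
    by (simp add: inner_ell2_def mult.commute)
  show "inner (x + y) z = inner x z + inner y z"
    by (simp add: inner_ell2_def distrib_right infsum_add coord_mult_summable)
  show "inner (r *\<^sub>R x) y = r * inner x y"
    by (simp add: inner_ell2_def mult.assoc infsum_cmult_right')
  show "0 \<le> inner x x"
    by (simp add: inner_ell2_def infsum_nonneg)
  show "inner x x = 0 \<longleftrightarrow> x = 0"
  proof
    assume *: "inner x x = 0"
    have "coord x i = coord 0 i" for i
      using nonneg_infsum_le_0D[OF _ coord_mult_summable[of x x], of i] *
      by (simp add: inner_ell2_def)
    then show "x = 0" by (rule ell2_eqI)
  qed (simp add: inner_ell2_def)
qed (simp_all add: norm_ell2_def dist_ell2_def sgn_ell2_def uniformity_ell2_def open_ell2_def)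

end

lemma norm_ell2_square: "(norm x)\<^sup>2 = (\<Sum>\<^sub>\<infinity>i. (coord x i)\<^sup>2)" for x :: ell2
  unfolding power2_norm_eq_inner inner_ell2_def by (simp add: power2_eq_square)

lemma sum_coord_square_le: "finite A \<Longrightarrow> (\<Sum>i\<in>A. (coord x i)\<^sup>2) \<le> (norm x)\<^sup>2"
  unfolding norm_ell2_square by (rule finite_sum_le_infsum[OF coord_square_summable]) auto

lemma abs_coord_le_norm: "\<bar>coord x i\<bar> \<le> norm x"
  using power2_le_imp_le[of "\<bar>coord x i\<bar>" "norm x"] sum_coord_square_le[of "{i}" x] by simp

instance ell2 :: banach
proof
  fix X :: "nat \<Rightarrow> ell2"
  assume X: "Cauchy X"
  have "Cauchy (\<lambda>n. coord (X n) i)" for i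
  proof (rule CauchyI)
    fix e :: real assume "e > 0"
    with X obtain M where M: "\<And>m n. m \<ge> M \<Longrightarrow> n \<ge> M \<Longrightarrow> norm (X m - X n) < e"
      unfolding Cauchy_iff by blast
    then show "\<exists>M. \<forall>m\<ge>M. \<forall>n\<ge>M. norm (coord (X m) i - coord (X n) i) < e"
      using le_less_trans[OF abs_coord_le_norm] by (metis minus_ell2.rep_eq real_norm_def)
  qed
  then have "\<exists>l. \<forall>i. (\<lambda>n. coord (X n) i) \<longlonglongrightarrow> l i"
    by (intro choice allI) (use real_Cauchy_convergent in \<open>auto simp: convergent_def\<close>)
  then obtain l where l: "\<And>i. (\<lambda>n. coord (X n) i) \<longlonglongrightarrow> l i" by blast
  have tail: "\<exists>M. \<forall>m\<ge>M. \<forall>A. finite A \<longrightarrow> (\<Sum>i\<in>A. (coord (X m) i - l i)\<^sup>2) \<le> e\<^sup>2" if "e > 0" for e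
  proof -
    from X \<open>e > 0\<close> obtain M where M: "\<And>m n. m \<ge> M \<Longrightarrow> n \<ge> M \<Longrightarrow> norm (X m - X n) < e"
      unfolding Cauchy_iff by blast
    have "(\<Sum>i\<in>A. (coord (X m) i - l i)\<^sup>2) \<le> e\<^sup>2" if "m \<ge> M" "finite A" for m A
    proof (rule LIMSEQ_le_const2)
      show "(\<lambda>n. \<Sum>i\<in>A. (coord (X m) i - coord (X n) i)\<^sup>2) \<longlonglongrightarrow> (\<Sum>i\<in>A. (coord (X m) i - l i)\<^sup>2)"
        by (intro tendsto_intros l)
      have "(\<Sum>i\<in>A. (coord (X m) i - coord (X n) i)\<^sup>2) \<le> e\<^sup>2" if "n \<ge> M" for n
      proof -
        have "(\<Sum>i\<in>A. (coord (X m) i - coord (X n) i)\<^sup>2) \<le> (norm (X m - X n))\<^sup>2"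
          using sum_coord_square_le[OF \<open>finite A\<close>, of "X m - X n"] by simp
        also have "\<dots> \<le> e\<^sup>2"
          using M[OF \<open>m \<ge> M\<close> \<open>n \<ge> M\<close>] by (intro power_mono) auto
        finally show ?thesis .
      qed
      then show "\<exists>N. \<forall>n\<ge>N. (\<Sum>i\<in>A. (coord (X m) i - coord (X n) i)\<^sup>2) \<le> e\<^sup>2" by blast
    qed
    then show ?thesis by blast
  qed
  obtain M where M: "\<And>A. finite A \<Longrightarrow> (\<Sum>i\<in>A. (coord (X M) i - l i)\<^sup>2) \<le> 1"
    using tail[of 1] by auto
  have "(\<lambda>i. (coord (X M) i - l i)\<^sup>2) summable_on UNIV"
    by (rule nonneg_bdd_above_summable_on) (auto intro!: bdd_aboveI2[where M=1] M)
  from square_summable_add[OF coord_square_summable[of "- X M"] this]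
  have "(\<lambda>i. (l i)\<^sup>2) summable_on UNIV" by simp
  then have L: "coord (Abs_ell2 l) = l" by (simp add: Abs_ell2_inverse)
  have "X \<longlonglongrightarrow> Abs_ell2 l"
  proof (rule LIMSEQ_I)
    fix e :: real assume "e > 0"
    then obtain M where M: "\<And>m A. m \<ge> M \<Longrightarrow> finite A \<Longrightarrow> (\<Sum>i\<in>A. (coord (X m) i - l i)\<^sup>2) \<le> (e/2)\<^sup>2"
      using tail[of "e/2"] by auto
    have "norm (X m - Abs_ell2 l) < e" if "m \<ge> M" for m
    proof -
      have "(norm (X m - Abs_ell2 l))\<^sup>2 \<le> (e/2)\<^sup>2"
        unfolding norm_ell2_square
        by (rule infsum_le_finite_sums[OF coord_square_summable]) (use M[OF that] L in simp)
      then have "norm (X m - Abs_ell2 l) \<le> e/2"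
        by (rule power2_le_imp_le) (use \<open>e > 0\<close> in simp)
      then show ?thesis using \<open>e > 0\<close> by simp
    qed
    then show "\<exists>M. \<forall>m\<ge>M. norm (X m - Abs_ell2 l) < e" by blast
  qed
  then show "convergent X" by (auto simp: convergent_def)
qed

text \<open>The space \<open>\<real>\<^sup>2\<^sup>n\<^sup>+\<^sup>1\<close>, in its identification with a subspace of \<open>\<ell>\<^sub>2\<close>: the sequences
  supported in \<open>\<bar>i\<bar> \<le> n\<close>. The norm of \<^typ>\<open>ell2\<close> restricts to the Euclidean norm on it.\<close>

definition coord_space :: "nat \<Rightarrow> ell2 set" where
  "coord_space n = {x. \<forall>i. \<bar>i\<bar> > int n \<longrightarrow> coord x i = 0}"

lift_definition trunc :: "nat \<Rightarrow> ell2 \<Rightarrow> ell2" is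
  "\<lambda>n x i. if \<bar>i\<bar> \<le> int n then x i else 0"
proof -
  fix n and x :: "int \<Rightarrow> real"
  assume *: "(\<lambda>i. (x i)\<^sup>2) summable_on UNIV"
  show "(\<lambda>i. (if \<bar>i\<bar> \<le> int n then x i else 0)\<^sup>2) summable_on UNIV"
    by (rule summable_on_comparison_test[OF *]) auto
qed

lemma range_trunc: "range (trunc n) = coord_space n"
proof
  show "range (trunc n) \<subseteq> coord_space n"
    by (auto simp: coord_space_def trunc.rep_eq)
  have "trunc n x = x" if "x \<in> coord_space n" for x
    using that by (intro ell2_eqI) (auto simp: coord_space_def trunc.rep_eq)
  then show "coord_space n \<subseteq> range (trunc n)" by (metis rangeI subsetI)
qed


section \<open>The shift dynamical system\<close>

text \<open>The empty compact set contributes the set of all continuous functions to the subbase, so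
  the carrier of this topology is \<open>C(X, Y)\<close>.\<close>

definition compact_open_topology ::
  "('a::topological_space \<Rightarrow> 'b::topological_space) topology" where
  "compact_open_topology =
     topology_generated_by
       {{f. continuous_on UNIV f \<and> f ` K \<subseteq> U} | K U. compact K \<and> open U}"

lemma topspace_compact_open_topology:
  "topspace compact_open_topology = {f. continuous_on UNIV f}"
proof
  show "topspace compact_open_topology \<subseteq> {f. continuous_on UNIV f}"
    by (auto simp: compact_open_topology_def topology_generated_by_topspace)
  have "f \<in> \<Union> {{f. continuous_on UNIV f \<and> f ` K \<subseteq> U} | K U. compact K \<and> open U}"
    if "continuous_on UNIV f" for f :: "'a \<Rightarrow> 'b"
    using that by (intro UnionI[where X = "{f. continuous_on UNIV f \<and> f ` {} \<subseteq> {}}"]) blast+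
  then show "{f. continuous_on UNIV f} \<subseteq> topspace (compact_open_topology :: ('a \<Rightarrow> 'b) topology)"
    by (auto simp: compact_open_topology_def topology_generated_by_topspace)
qed

definition shift :: "real \<Rightarrow> (real \<Rightarrow> 'b) \<Rightarrow> (real \<Rightarrow> 'b)" where
  "shift h f = (\<lambda>t. f (t + h))"

text \<open>For \<open>f\<close> with values in \<^term>\<open>coord_space n\<close> the closure may be taken in \<open>C(\<real>, \<ell>\<^sub>2)\<close>,
  because \<^term>\<open>coord_space n\<close> is closed.\<close>

definition shift_hull :: "(real \<Rightarrow> 'b::topological_space) \<Rightarrow> (real \<Rightarrow> 'b) set" where
  "shift_hull f = compact_open_topology closure_of (range (\<lambda>h. shift h f))"

definition lagrange_stable :: "(real \<Rightarrow> 'b::topological_space) \<Rightarrow> bool" where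
  "lagrange_stable f \<longleftrightarrow> compactin compact_open_topology (shift_hull f)"


section \<open>Compact global attractors of cocycles\<close>

definition hausdorff_semidist :: "'a::metric_space set \<Rightarrow> 'a set \<Rightarrow> ennreal" where
  "hausdorff_semidist A B = (SUP a\<in>A. INF b\<in>B. ennreal (dist a b))"

text \<open>Below, \<open>W\<close> is the fibre, \<open>Y\<close> the base, \<open>\<sigma>\<close> the flow on the base and \<open>\<phi>\<close> the cocycle.\<close>

definition attracting_compact ::
  "'w::metric_space set \<Rightarrow> 'y set \<Rightarrow> (real \<Rightarrow> 'w \<Rightarrow> 'y \<Rightarrow> 'w) \<Rightarrow> 'w set \<Rightarrow> bool" where
  "attracting_compact W Y \<phi> K \<longleftrightarrow>
     compact K \<and> K \<noteq> {} \<and> K \<subseteq> W \<and>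
     (\<forall>M. compact M \<and> M \<subseteq> W \<longrightarrow>
        ((\<lambda>t. SUP y\<in>Y. hausdorff_semidist ((\<lambda>u. \<phi> t u y) ` M) K) \<longlongrightarrow> 0) at_top)"

text \<open>For a uniformly compactly dissipative cocycle, that is, one that has an attracting compact
  set, the Levinson center does not depend on which attracting compact set is chosen. The
  intersection with \<open>W\<close> makes the closure the one in \<open>W\<close>.\<close>

definition levinson_center ::
  "'w::metric_space set \<Rightarrow> 'y set \<Rightarrow> (real \<Rightarrow> 'y \<Rightarrow> 'y) \<Rightarrow> (real \<Rightarrow> 'w \<Rightarrow> 'y \<Rightarrow> 'w) \<Rightarrow> 'y \<Rightarrow> 'w set"
  where
  "levinson_center W Y \<sigma> \<phi> y =
     (let K = SOME K. attracting_compact W Y \<phi> K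
      in \<Inter>t\<in>{0..}. W \<inter> closure (\<Union>\<tau>\<in>{t..}. (\<lambda>u. \<phi> \<tau> u (\<sigma> (- \<tau>) y)) ` K))"


section \<open>The lattice system and its periodic approximations\<close>

definition lattice_solution ::
  "real \<Rightarrow> real \<Rightarrow> (real \<Rightarrow> real) \<Rightarrow> (real \<Rightarrow> ell2) \<Rightarrow> ell2 \<Rightarrow> (real \<Rightarrow> ell2) \<Rightarrow> bool" where
  "lattice_solution \<nu> lam F g v u \<longleftrightarrow>
     u 0 = v \<and>
     (\<forall>t\<ge>0. \<exists>w. (u has_vector_derivative w) (at t within {0..}) \<and>
        (\<forall>i. coord w i =
           \<nu> * (coord (u t) (i - 1) - 2 * coord (u t) i + coord (u t) (i + 1))
           - lam * coord (u t) i + F (coord (u t) i) + coord (g t) i))"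

text \<open>The choice operators select the solution, which exists on the whole half-line \<open>t \<ge> 0\<close> and is
  unique there; the values for \<open>t < 0\<close> are irrelevant.\<close>

definition lattice_cocycle ::
  "real \<Rightarrow> real \<Rightarrow> (real \<Rightarrow> real) \<Rightarrow> real \<Rightarrow> ell2 \<Rightarrow> (real \<Rightarrow> ell2) \<Rightarrow> ell2" where
  "lattice_cocycle \<nu> lam F t v g = (SOME u. lattice_solution \<nu> lam F g v u) t"

definition left_nb :: "nat \<Rightarrow> int \<Rightarrow> int" where
  "left_nb n i = (if i = - int n then int n else i - 1)"

definition right_nb :: "nat \<Rightarrow> int \<Rightarrow> int" where
  "right_nb n i = (if i = int n then - int n else i + 1)"

definition approx_solution ::
  "real \<Rightarrow> real \<Rightarrow> (real \<Rightarrow> real) \<Rightarrow> nat \<Rightarrow> (real \<Rightarrow> ell2) \<Rightarrow> ell2 \<Rightarrow> (real \<Rightarrow> ell2) \<Rightarrow> bool" where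
  "approx_solution \<nu> lam F n g v u \<longleftrightarrow>
     u 0 = v \<and> (\<forall>t\<ge>0. u t \<in> coord_space n) \<and>
     (\<forall>t\<ge>0. \<exists>w. (u has_vector_derivative w) (at t within {0..}) \<and>
        (\<forall>i. \<bar>i\<bar> \<le> int n \<longrightarrow> coord w i =
           \<nu> * (coord (u t) (left_nb n i) - 2 * coord (u t) i + coord (u t) (right_nb n i))
           - lam * coord (u t) i + F (coord (u t) i) + coord (g t) i))"

definition approx_cocycle ::
  "real \<Rightarrow> real \<Rightarrow> (real \<Rightarrow> real) \<Rightarrow> nat \<Rightarrow> real \<Rightarrow> ell2 \<Rightarrow> (real \<Rightarrow> ell2) \<Rightarrow> ell2" where
  "approx_cocycle \<nu> lam F n t v g = (SOME u. approx_solution \<nu> lam F n g v u) t"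

definition lattice_attractor ::
  "real \<Rightarrow> real \<Rightarrow> (real \<Rightarrow> real) \<Rightarrow> (real \<Rightarrow> ell2) \<Rightarrow> (real \<Rightarrow> ell2) \<Rightarrow> ell2 set" where
  "lattice_attractor \<nu> lam F f =
     levinson_center UNIV (shift_hull f) shift (lattice_cocycle \<nu> lam F)"

text \<open>Here \<open>f\<close> is the truncated forcing, with values in \<^term>\<open>coord_space n\<close>.\<close>

definition approx_attractor ::
  "real \<Rightarrow> real \<Rightarrow> (real \<Rightarrow> real) \<Rightarrow> nat \<Rightarrow> (real \<Rightarrow> ell2) \<Rightarrow> (real \<Rightarrow> ell2) \<Rightarrow> ell2 set" where
  "approx_attractor \<nu> lam F n f =
     levinson_center (coord_space n) (shift_hull f) shift (approx_cocycle \<nu> lam F n)"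

end

theory Submission
  imports Defs
begin

text \<open>
  Both the lattice system and its periodic approximation are the same equation on \<open>\<ell>\<^sub>2\<close>,
  \<open>u' = \<nu> (S u + S\<^sup>* u - 2 u) - \<lambda> u + F(u) + g\<close>, where \<open>S\<close> permutes coordinates: the permutation is
  \<open>i \<mapsto> i + 1\<close> on the whole lattice, and for the approximation it is the cyclic shift of
  \<open>{- n..n}\<close>, extended by the identity (\<open>field\<close>, \<open>solves\<close>). Hence every estimate is proved once, for
  a permutation that moves \<open>\<bar>i\<bar>\<close> by at most one (\<open>near_shift\<close>), and is uniform in \<open>n\<close>: the wrap
  from \<open>n\<close> to \<open>- n\<close> does not change \<open>\<bar>i\<bar>\<close> at all.

  Two estimates carry the dynamics. The coupling is dissipative for the energy \<open>\<Sum>i. \<theta> i * (u i)\<^sup>2\<close> up to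
  an error of the size of the slope of the weight \<open>\<theta>\<close> (\<open>weighted_dissipation\<close>). With \<open>\<theta> = 1\<close> this
  bounds the norm; with a slowly growing cut-off it bounds the mass far out on the lattice
  (\<open>tail_decay\<close>), because the forcings in the hull take values in a compact set and so have uniformly
  small tails. Bounded sets with uniformly small tails are relatively compact
  (\<open>compact_bounded_uniform_tail\<close>), so one compact set \<open>absorbing\<close>, intersected with the phase
  space, attracts in each of the systems. The second estimate compares two solutions (\<open>perturbation_estimate\<close>). It gives uniqueness,
  continuity in the initial value, and, since the two couplings differ only near \<open>\<bar>i\<bar> = n\<close>, where
  solutions started in \<open>absorbing\<close> are small, the convergence of the approximating cocycle to the
  lattice cocycle on a fixed time interval (\<open>periodic_approximation_converges\<close>).

  The theorem follows by pulling back. A point of the attractor of the approximation at \<open>f\<^sup>n\<close> is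
  the value at time \<open>T\<close> of a solution that starts in \<open>absorbing\<close> with the forcing moved back by \<open>T\<close>
  (\<open>levinson_center_pullback\<close>). For \<open>T\<close> large and fixed, the lattice cocycle carries the compact
  set \<open>absorbing\<close>, pulled back by \<open>T\<close>, close to the lattice attractor
  (\<open>levinson_center_attracts_pullback\<close>); for \<open>n\<close> large, the two cocycles are close at time \<open>T\<close>.
\<close>

section \<open>Comparison of coordinates\<close>

lemma square_summable_dominated:
  assumes "\<And>i. \<bar>h i\<bar> \<le> L * \<bar>coord x i\<bar>"
  shows "(\<lambda>i. (h i)\<^sup>2) summable_on UNIV"
proof (rule summable_on_comparison_test)
  show "(\<lambda>i. (L * coord x i)\<^sup>2) summable_on UNIV"
    by (rule square_summable_scale) (rule coord_square_summable)
  show "(h i)\<^sup>2 \<le> (L * coord x i)\<^sup>2" for i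
  proof -
    have "\<bar>h i\<bar> \<le> \<bar>L * coord x i\<bar>"
      using assms[of i] mult_right_mono[OF abs_ge_self[of L], of "\<bar>coord x i\<bar>"]
      by (simp add: abs_mult)
    then show ?thesis by (simp only: abs_le_square_iff)
  qed
qed simp

lemma norm_le_of_coord_le:
  assumes "0 \<le> L" "\<And>i. \<bar>coord z i\<bar> \<le> L * \<bar>coord x i\<bar>"
  shows "norm z \<le> L * norm x"
proof (rule power2_le_imp_le)
  have "(norm z)\<^sup>2 \<le> (\<Sum>\<^sub>\<infinity>i. (L * coord x i)\<^sup>2)"
    unfolding norm_ell2_square
  proof (rule infsum_mono)
    show "(coord z i)\<^sup>2 \<le> (L * coord x i)\<^sup>2" for i
      using assms(2)[of i] assms(1) by (metis abs_le_square_iff abs_mult abs_of_nonneg)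
  qed (auto intro: coord_square_summable square_summable_scale)
  also have "\<dots> = (L * norm x)\<^sup>2"
    by (simp add: power_mult_distrib norm_ell2_square infsum_cmult_right')
  finally show "(norm z)\<^sup>2 \<le> (L * norm x)\<^sup>2" .
  show "0 \<le> L * norm x" using assms(1) by simp
qed

lemma inner_mono_coord:
  assumes "\<And>i. coord a i * coord b i \<le> coord c i * coord d i"
  shows "inner a b \<le> inner c d"
  unfolding inner_ell2_def by (rule infsum_mono) (auto intro: coord_mult_summable assms)

section \<open>Truncation and tails\<close>

lemma norm_trunc_le: "norm (trunc n x) \<le> norm x"
  using norm_le_of_coord_le[of 1 "trunc n x" x] by (simp add: trunc.rep_eq)

lemma trunc_diff: "trunc n (x - y) = trunc n x - trunc n y"
  by (rule ell2_eqI) (simp add: trunc.rep_eq)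

lemma dist_trunc_le: "dist (trunc n x) (trunc n y) \<le> dist x y"
  unfolding dist_norm trunc_diff[symmetric] by (rule norm_trunc_le)

lemma continuous_on_trunc [continuous_intros]:
  assumes "continuous_on S f" shows "continuous_on S (\<lambda>t. trunc n (f t))"
proof -
  have "1-lipschitz_on UNIV (trunc n)"
    by (rule lipschitz_onI) (auto simp: dist_trunc_le)
  then have "continuous_on UNIV (trunc n)" by (rule lipschitz_on_continuous_on)
  from continuous_on_compose2[OF this assms] show ?thesis by simp
qed

definition tail :: "nat \<Rightarrow> ell2 \<Rightarrow> real" where
  "tail n x = norm (x - trunc n x)"

lemma tail_nonneg [simp]: "0 \<le> tail n x" by (simp add: tail_def)

lemma tail_antimono: "m \<le> n \<Longrightarrow> tail n x \<le> tail m x"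
  unfolding tail_def
  using norm_le_of_coord_le[of 1 "x - trunc n x" "x - trunc m x"] by (simp add: trunc.rep_eq)

lemma tail_trunc_le: "tail n (trunc m x) \<le> tail n x"
  unfolding tail_def
  using norm_le_of_coord_le[of 1 "trunc m x - trunc n (trunc m x)" "x - trunc n x"]
  by (simp add: trunc.rep_eq)

lemma tail_trunc_eq_0: "m \<le> n \<Longrightarrow> tail n (trunc m x) = 0"
  unfolding tail_def by (simp, rule ell2_eqI) (simp add: trunc.rep_eq)

lemma tail_le_norm: "tail N x \<le> norm x"
  unfolding tail_def using norm_le_of_coord_le[of 1 "x - trunc N x" x] by (simp add: trunc.rep_eq)

lemma tail_lipschitz: "tail n x \<le> tail n y + dist x y"
proof -
  have "x - trunc n x = (y - trunc n y) + ((x - y) - trunc n (x - y))"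
    by (simp add: trunc_diff)
  then have "norm (x - trunc n x) \<le> norm (y - trunc n y) + norm ((x - y) - trunc n (x - y))"
    by (metis norm_triangle_ineq)
  moreover have "norm ((x - y) - trunc n (x - y)) \<le> norm (x - y)"
    using norm_le_of_coord_le[of 1 "(x - y) - trunc n (x - y)" "x - y"] by (simp add: trunc.rep_eq)
  ultimately show ?thesis unfolding tail_def dist_norm by linarith
qed

lemma continuous_on_tail: "continuous_on S (tail n)"
  unfolding tail_def by (intro continuous_intros continuous_on_id)

lemma norm_square_split: "(norm x)\<^sup>2 = (norm (trunc n x))\<^sup>2 + (tail n x)\<^sup>2"
proof -
  have "inner (trunc n x) (x - trunc n x) = (\<Sum>\<^sub>\<infinity>i::int. 0)"
    unfolding inner_ell2_def by (rule infsum_cong) (simp add: trunc.rep_eq)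
  then have "inner (trunc n x) x = inner (trunc n x) (trunc n x)"
    by (simp add: inner_diff_right)
  then show ?thesis
    unfolding tail_def power2_norm_eq_inner
    by (simp add: inner_diff_right inner_diff_left inner_commute)
qed

lemma norm_trunc_square: "(norm (trunc n x))\<^sup>2 = (\<Sum>i\<in>{- int n..int n}. (coord x i)\<^sup>2)"
proof -
  have "(norm (trunc n x))\<^sup>2 = (\<Sum>\<^sub>\<infinity>i. (coord (trunc n x) i)\<^sup>2)"
    by (rule norm_ell2_square)
  also have "\<dots> = (\<Sum>\<^sub>\<infinity>i\<in>{- int n..int n}. (coord x i)\<^sup>2)"
    by (rule infsum_cong_neutral) (auto simp: trunc.rep_eq)
  finally show ?thesis by simp
qed

lemma tail_tendsto_0: "(\<lambda>n. tail n x) \<longlonglongrightarrow> 0"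
proof (rule LIMSEQ_I)
  fix e :: real assume "e > 0"
  have "((\<lambda>i. (coord x i)\<^sup>2) has_sum (norm x)\<^sup>2) UNIV"
    unfolding norm_ell2_square using coord_square_summable by (rule has_sum_infsum)
  then have "\<forall>\<^sub>F A in finite_subsets_at_top UNIV. dist (\<Sum>i\<in>A. (coord x i)\<^sup>2) ((norm x)\<^sup>2) < e\<^sup>2"
    unfolding has_sum_def by (rule tendstoD) (use \<open>e > 0\<close> in simp)
  then obtain A where A: "finite A"
    "\<And>B. finite B \<Longrightarrow> A \<subseteq> B \<Longrightarrow> dist (\<Sum>i\<in>B. (coord x i)\<^sup>2) ((norm x)\<^sup>2) < e\<^sup>2"
    unfolding eventually_finite_subsets_at_top by auto
  obtain N where N: "\<And>i. i \<in> A \<Longrightarrow> nat \<bar>i\<bar> \<le> N"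
    using A(1) finite_nat_set_iff_bounded_le[of "(\<lambda>i. nat \<bar>i\<bar>) ` A"] by auto
  have "tail n x < e" if "n \<ge> N" for n
  proof -
    have "A \<subseteq> {- int n..int n}" using N that by force
    then have "dist (\<Sum>i\<in>{- int n..int n}. (coord x i)\<^sup>2) ((norm x)\<^sup>2) < e\<^sup>2"
      by (intro A(2)) auto
    then have "(tail n x)\<^sup>2 < e\<^sup>2"
      using norm_square_split[of x n] by (simp add: norm_trunc_square dist_real_def)
    then show ?thesis using \<open>e > 0\<close> by (auto intro: power2_less_imp_less)
  qed
  then show "\<exists>N. \<forall>n\<ge>N. norm (tail n x - 0) < e" by auto
qed

text \<open>The tail is 1-Lipschitz in the point, so a finite net of the compact set reduces uniform
  smallness to the pointwise limit \<open>tail_tendsto_0\<close>.\<close>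

lemma compact_uniform_tail:
  assumes "compact Q"
  obtains \<gamma> :: "nat \<Rightarrow> real" where "\<gamma> \<longlonglongrightarrow> 0" "\<And>N q. q \<in> Q \<Longrightarrow> tail N q \<le> \<gamma> N"
proof
  let ?\<gamma> = "\<lambda>N. if Q = {} then 0 else SUP q\<in>Q. tail N q"
  have bdd: "bdd_above (tail N ` Q)" for N
    by (intro bounded_imp_bdd_above compact_imp_bounded compact_continuous_image
        continuous_on_tail assms)
  show "tail N q \<le> ?\<gamma> N" if "q \<in> Q" for N q
    using that bdd[of N] by (auto intro: cSUP_upper)
  show "?\<gamma> \<longlonglongrightarrow> 0"
  proof (rule LIMSEQ_I)
    fix e :: real assume "e > 0"
    then obtain k where k: "finite k" "Q \<subseteq> (\<Union>x\<in>k. ball x (e/3))"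
      using compact_imp_seq_compact[OF assms, THEN seq_compact_imp_totally_bounded]
      by (metis divide_pos_pos zero_less_numeral)
    have "\<forall>\<^sub>F N in sequentially. \<forall>x\<in>k. tail N x < e/3"
      using order_tendstoD(2)[OF tail_tendsto_0, of "e/3"] \<open>e > 0\<close> k(1)
      by (auto intro!: eventually_ball_finite)
    then obtain M where M: "\<And>N x. N \<ge> M \<Longrightarrow> x \<in> k \<Longrightarrow> tail N x < e/3"
      unfolding eventually_sequentially by blast
    have *: "tail N q \<le> 2 * e / 3" if "N \<ge> M" "q \<in> Q" for N q
    proof -
      from \<open>q \<in> Q\<close> obtain x where "x \<in> k" "dist x q < e/3" using k(2) by auto
      then show ?thesis
        using tail_lipschitz[of N q x] M[OF \<open>N \<ge> M\<close>, of x] by (simp add: dist_commute)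
    qed
    then have upper: "?\<gamma> N \<le> 2 * e / 3" if "N \<ge> M" for N
    proof (cases "Q = {}")
      case False
      then have "(SUP q\<in>Q. tail N q) \<le> 2 * e / 3"
        by (rule cSUP_least) (use * that in blast)
      with False show ?thesis by simp
    qed (use \<open>e > 0\<close> in simp)
    have lower: "0 \<le> ?\<gamma> N" for N
    proof (cases "Q = {}")
      case False
      then obtain q where "q \<in> Q" by blast
      then have "tail N q \<le> (SUP q\<in>Q. tail N q)" by (rule cSUP_upper[OF _ bdd])
      with order_trans[OF tail_nonneg] have "0 \<le> (SUP q\<in>Q. tail N q)" by blast
      with False show ?thesis by simp
    qed simp
    have "norm (?\<gamma> N - 0) < e" if "N \<ge> M" for N
      using upper[OF that] lower[of N] \<open>e > 0\<close> unfolding real_norm_def by linarith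
    then show "\<exists>M. \<forall>N\<ge>M. norm (?\<gamma> N - 0) < e" by blast
  qed
qed

section \<open>A compactness criterion\<close>

text \<open>The coordinate sequences lie in a product of compact intervals over the countable index set
  \<open>\<int>\<close>, which is compact and metrizable.\<close>

lemma bounded_coord_subsequence:
  fixes X :: "nat \<Rightarrow> ell2"
  assumes "\<And>k. norm (X k) \<le> \<rho>"
  obtains s l where "strict_mono s" "\<And>i. (\<lambda>k. coord (X (s k)) i) \<longlonglongrightarrow> l i"
proof -
  let ?B = "PiE UNIV (\<lambda>_::int. {- \<rho>..\<rho>})"
  have "compactin (product_topology (\<lambda>_::int. euclideanreal) UNIV) ?B"
    by (subst compactin_PiE) auto
  then have "compact ?B" by (simp add: euclidean_product_topology)
  then have "seq_compact ?B" by (rule compact_imp_seq_compact)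
  moreover have "\<forall>k. (\<lambda>k. coord (X k)) k \<in> ?B"
    using order_trans[OF abs_coord_le_norm assms] by (force simp: abs_le_iff)
  ultimately obtain l s where "l \<in> ?B" "strict_mono s" and l: "((\<lambda>k. coord (X k)) \<circ> s) \<longlonglongrightarrow> l"
    by (rule seq_compactE)
  then have "(\<lambda>k. coord (X (s k)) i) \<longlonglongrightarrow> l i" for i
    using continuous_on_tendsto_compose[OF continuous_on_product_coordinates l, of i]
    by (simp add: o_def)
  with \<open>strict_mono s\<close> that show ?thesis by blast
qed

text \<open>Up to the uniformly small tails only finitely many coordinates matter, and on those
  coordinatewise convergence is convergence in norm.\<close>

lemma Cauchy_if_coord_Cauchy_uniform_tail:
  fixes X :: "nat \<Rightarrow> ell2"
  assumes l: "\<And>i. (\<lambda>k. coord (X k) i) \<longlonglongrightarrow> l i"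
    and t: "\<And>k N. tail N (X k) \<le> \<kappa> N" and "\<kappa> \<longlonglongrightarrow> 0"
  shows "Cauchy X"
proof (rule CauchyI)
  fix e :: real assume "e > 0"
  obtain N where N: "\<kappa> N < e/3"
    using order_tendstoD(2)[OF \<open>\<kappa> \<longlonglongrightarrow> 0\<close>, of "e/3"] \<open>e > 0\<close>
    by (auto simp: eventually_sequentially)
  have c: "Cauchy (\<lambda>k. trunc N (X k))"
  proof -
    define Y where "Y = Abs_ell2 (\<lambda>i. if \<bar>i\<bar> \<le> int N then l i else 0)"
    have "(\<lambda>i. (if \<bar>i\<bar> \<le> int N then l i else 0)\<^sup>2) summable_on UNIV"
      by (rule finite_nonzero_values_imp_summable_on)
        (rule finite_subset[of _ "{- int N..int N}"], auto)
    then have Y: "coord Y i = (if \<bar>i\<bar> \<le> int N then l i else 0)" for i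
      by (simp add: Y_def Abs_ell2_inverse)
    have "(\<lambda>k. (norm (trunc N (X k - Y)))\<^sup>2) \<longlonglongrightarrow> (\<Sum>i\<in>{- int N..int N}. (l i - coord Y i)\<^sup>2)"
      unfolding norm_trunc_square minus_ell2.rep_eq by (intro tendsto_intros l)
    moreover have "(\<Sum>i\<in>{- int N..int N}. (l i - coord Y i)\<^sup>2) = 0"
      by (intro sum.neutral) (auto simp: Y)
    ultimately have "(\<lambda>k. (norm (trunc N (X k - Y)))\<^sup>2) \<longlonglongrightarrow> 0" by simp
    from tendsto_real_sqrt[OF this] have "(\<lambda>k. norm (trunc N (X k - Y))) \<longlonglongrightarrow> 0"
      by simp
    then have "(\<lambda>k. trunc N (X k)) \<longlonglongrightarrow> trunc N Y"
      by (simp add: trunc_diff tendsto_norm_zero_iff LIM_zero_iff)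
    then show ?thesis by (rule LIMSEQ_imp_Cauchy)
  qed
  obtain M where M: "\<And>m n. m \<ge> M \<Longrightarrow> n \<ge> M \<Longrightarrow> norm (trunc N (X m) - trunc N (X n)) < e/3"
    using CauchyD[OF c, of "e/3"] \<open>e > 0\<close> by auto
  have "norm (X m - X n) < e" if "m \<ge> M" "n \<ge> M" for m n
  proof -
    have eq: "X m - X n = (trunc N (X m) - trunc N (X n)) + (X m - trunc N (X m)) - (X n - trunc N (X n))"
      by simp
    have "norm (X m - X n) \<le> norm (trunc N (X m) - trunc N (X n)) + tail N (X m) + tail N (X n)"
      unfolding tail_def
      by (subst eq) (rule order_trans[OF norm_triangle_ineq4 add_right_mono[OF norm_triangle_ineq]])
    also have "\<dots> < e" using M[OF that] t[of N m] t[of N n] N by linarith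
    finally show ?thesis .
  qed
  then show "\<exists>M. \<forall>m\<ge>M. \<forall>n\<ge>M. norm (X m - X n) < e" by blast
qed

text \<open>This stands in for local compactness, which \<open>\<ell>\<^sub>2\<close> lacks. Intersected
  with a closed coordinate subspace, the same set serves the finite-dimensional phase spaces.\<close>

lemma compact_bounded_uniform_tail:
  assumes "\<kappa> \<longlonglongrightarrow> 0"
  shows "compact {x. norm x \<le> \<rho> \<and> (\<forall>N. tail N x \<le> \<kappa> N)}" (is "compact ?K")
unfolding compact_eq_seq_compact_metric
proof (rule seq_compactI)
  fix X :: "nat \<Rightarrow> ell2" assume "\<forall>n. X n \<in> ?K"
  then have X: "\<And>k. norm (X k) \<le> \<rho>" "\<And>k N. tail N (X k) \<le> \<kappa> N" by auto
  obtain s l where s: "strict_mono s" "\<And>i. (\<lambda>k. coord (X (s k)) i) \<longlonglongrightarrow> l i"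
    using bounded_coord_subsequence[of X \<rho>] X(1) by blast
  have "Cauchy (X \<circ> s)"
    by (rule Cauchy_if_coord_Cauchy_uniform_tail[where l = l and \<kappa> = \<kappa>]) (use s X assms in auto)
  then obtain x where x: "(X \<circ> s) \<longlonglongrightarrow> x" by (auto simp: Cauchy_convergent_iff convergent_def)
  have "closed ?K"
    by (intro closed_Collect_conj closed_Collect_all closed_Collect_le continuous_on_tail continuous_intros)
  moreover have "\<forall>k. (X \<circ> s) k \<in> ?K" using X by auto
  ultimately have "x \<in> ?K" using x closed_sequentially by blast
  with s(1) x show "\<exists>l\<in>?K. \<exists>r. strict_mono r \<and> (X \<circ> r) \<longlonglongrightarrow> l" by blast
qed

lemma closed_coord_space: "closed (coord_space n)"
proof -
  have "coord_space n = {x. trunc n x = x}"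
  proof (intro set_eqI iffI; clarify)
    fix x assume "x \<in> coord_space n"
    then show "trunc n x = x" by (intro ell2_eqI) (auto simp: coord_space_def trunc.rep_eq)
  next
    fix x assume "trunc n x = x"
    then have "x \<in> range (trunc n)" by (metis rangeI)
    then show "x \<in> coord_space n" by (simp only: range_trunc)
  qed
  also have "closed \<dots>"
    by (intro closed_Collect_eq continuous_intros continuous_on_id)
  finally show ?thesis .
qed

lemma trunc_coord_space: "x \<in> coord_space n \<Longrightarrow> trunc m x \<in> coord_space n"
  by (simp add: coord_space_def trunc.rep_eq)

section \<open>Coordinatewise operators\<close>

definition permute :: "(int \<Rightarrow> int) \<Rightarrow> ell2 \<Rightarrow> ell2" where
  "permute p x = Abs_ell2 (\<lambda>i. coord x (p i))"

lemma coord_permute [simp]: "bij p \<Longrightarrow> coord (permute p x) i = coord x (p i)"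
  using summable_on_reindex_bij_betw[of p UNIV UNIV "\<lambda>i. (coord x i)\<^sup>2"] coord_square_summable[of x]
  by (simp add: permute_def Abs_ell2_inverse)

lemma inner_permute: "bij p \<Longrightarrow> inner (permute p x) (permute p y) = inner x y"
  using infsum_reindex_bij_betw[of p UNIV UNIV "\<lambda>i. coord x i * coord y i"]
  by (simp add: inner_ell2_def)

lemma norm_permute: "bij p \<Longrightarrow> norm (permute p x) = norm x"
  by (simp add: norm_eq_sqrt_inner inner_permute)

lemma permute_diff: "bij p \<Longrightarrow> permute p (x - y) = permute p x - permute p y"
  by (rule ell2_eqI) simp

text \<open>Weighted energies are written \<open>inner (weigh \<theta> x) x\<close>. The weight
  \<open>1\<close> gives the squared norm, a cut-off the energy far out.\<close>

definition weigh :: "(int \<Rightarrow> real) \<Rightarrow> ell2 \<Rightarrow> ell2" where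
  "weigh \<theta> x = Abs_ell2 (\<lambda>i. \<theta> i * coord x i)"

definition weight :: "(int \<Rightarrow> real) \<Rightarrow> bool" where
  "weight \<theta> \<longleftrightarrow> (\<forall>i. 0 \<le> \<theta> i \<and> \<theta> i \<le> 1)"

lemma coord_weigh [simp]: "weight \<theta> \<Longrightarrow> coord (weigh \<theta> x) i = \<theta> i * coord x i"
  using square_summable_dominated[of "\<lambda>i. \<theta> i * coord x i" 1 x]
  by (simp add: weigh_def Abs_ell2_inverse abs_mult weight_def mult_left_le_one_le)

lemma bounded_linear_weigh: assumes "weight \<theta>" shows "bounded_linear (weigh \<theta>)"
proof (rule bounded_linear_intro[where K = 1])
  show "norm (weigh \<theta> x) \<le> norm x * 1" for x
    using norm_le_of_coord_le[of 1 "weigh \<theta> x" x] assms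
    by (simp add: abs_mult weight_def mult_left_le_one_le)
qed (auto intro!: ell2_eqI simp: assms algebra_simps)

section \<open>The equation with a general coupling permutation\<close>

definition pointwise :: "(real \<Rightarrow> real) \<Rightarrow> ell2 \<Rightarrow> ell2" where
  "pointwise F x = Abs_ell2 (\<lambda>i. F (coord x i))"

text \<open>The permutation \<open>p\<close> sends a site to its right neighbour. This one field covers the
  whole lattice and every periodic approximation.\<close>

definition field :: "real \<Rightarrow> real \<Rightarrow> (real \<Rightarrow> real) \<Rightarrow> (int \<Rightarrow> int) \<Rightarrow> ell2 \<Rightarrow> ell2" where
  "field \<nu> lam F p x =
     \<nu> *\<^sub>R (permute p x + permute (inv p) x - 2 *\<^sub>R x) - lam *\<^sub>R x + pointwise F x"

definition solves :: "real \<Rightarrow> real \<Rightarrow> (real \<Rightarrow> real) \<Rightarrow> (int \<Rightarrow> int) \<Rightarrow>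
    (real \<Rightarrow> ell2) \<Rightarrow> ell2 \<Rightarrow> (real \<Rightarrow> ell2) \<Rightarrow> bool" where
  "solves \<nu> lam F p g v u \<longleftrightarrow> u 0 = v \<and>
     (\<forall>t\<ge>0. (u has_vector_derivative (field \<nu> lam F p (u t) + g t)) (at t within {0..}))"

text \<open>A solution restarted at time \<open>s\<close> solves the equation with the shifted forcing;
  this is the cocycle identity in terms of solutions.\<close>

lemma solves_shift:
  assumes "solves \<nu> lam F p g v u" "0 \<le> s"
  shows "solves \<nu> lam F p (shift s g) (u s) (\<lambda>t. u (t + s))"
  unfolding solves_def
proof (intro conjI allI impI)
  fix t :: real assume "0 \<le> t"
  have *: "(u has_vector_derivative (field \<nu> lam F p (u (t + s)) + g (t + s))) (at (t + s) within {s..})"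
    using assms \<open>0 \<le> t\<close> unfolding solves_def
    by (auto intro: has_vector_derivative_within_subset[where S = "{0..}"])
  have "((\<lambda>t. t + s) has_vector_derivative 1) (at t within {0..})"
    by (auto intro!: derivative_eq_intros)
  moreover have "(\<lambda>t. t + s) ` {0..} = {s..}"
    using image_add_atLeast[of s 0] by (simp add: add.commute[of _ s])
  ultimately
  have "((u \<circ> (\<lambda>t. t + s)) has_vector_derivative 1 *\<^sub>R (field \<nu> lam F p (u (t + s)) + g (t + s)))
    (at t within {0..})"
    using vector_diff_chain_within[of "\<lambda>t. t + s" 1 t "{0..}" u] * by simp
  then show "((\<lambda>t. u (t + s)) has_vector_derivative (field \<nu> lam F p (u (t + s)) + shift s g t))
    (at t within {0..})"
    by (simp add: o_def shift_def)
qed simp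

text \<open>Multiplied by the integrating factor \<open>exp (- a t)\<close>, the function \<open>y + c /
  a\<close> becomes nonincreasing. Negative \<open>a\<close> is used for decay of energies,
  positive \<open>a\<close> as Gronwall's inequality for differences.\<close>

lemma differential_inequality:
  fixes y :: "real \<Rightarrow> real"
  assumes deriv: "\<And>t. 0 \<le> t \<Longrightarrow> (y has_real_derivative y' t) (at t within {0..})"
    and le: "\<And>t. 0 \<le> t \<Longrightarrow> y' t \<le> a * y t + c"
    and "a \<noteq> 0" "0 \<le> t"
  shows "y t \<le> exp (a * t) * (y 0 + c / a) - c / a"
proof -
  let ?z = "\<lambda>t. exp (- a * t) * (y t + c / a)"
  have z: "(?z has_real_derivative exp (- a * s) * (y' s - a * y s - c)) (at s within {0..})"
    if "0 \<le> s" for s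
    using \<open>a \<noteq> 0\<close>
    by (auto intro!: derivative_eq_intros deriv[OF that] simp: field_simps)
  have "?z t \<le> ?z 0"
  proof (rule DERIV_nonpos_imp_decreasing_open[OF \<open>0 \<le> t\<close>])
    show "\<exists>d. (?z has_real_derivative d) (at s) \<and> d \<le> 0" if "0 < s" "s < t" for s
    proof (intro exI conjI)
      show "(?z has_real_derivative exp (- a * s) * (y' s - a * y s - c)) (at s)"
      proof -
        have "at s within {0..} = at s"
          using that by (intro at_within_open_subset[of s "{0<..}"]) auto
        with z[of s] that show ?thesis by simp
      qed
      show "exp (- a * s) * (y' s - a * y s - c) \<le> 0"
        using le[of s] that by (intro mult_nonneg_nonpos) auto
    qed
    show "continuous_on {0..t} ?z"
    proof (rule continuous_on_subset[of "{0..}"])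
      show "continuous_on {0..} ?z"
        unfolding continuous_on_eq_continuous_within using DERIV_continuous[OF z] by blast
    qed auto
  qed
  then have "exp (a * t) * ?z t \<le> exp (a * t) * (y 0 + c / a)" by simp
  then show ?thesis by (simp add: mult.assoc[symmetric] exp_add[symmetric])
qed

locale dissipative_lattice =
  fixes \<nu> lam :: real and F :: "real \<Rightarrow> real"
  assumes nu_pos: "0 < \<nu>" and lam_pos: "0 < lam"
    and loc_lip: "\<And>r. \<exists>L. L-lipschitz_on {-r..r} F"
    and F_0: "F 0 = 0" and F_sign: "\<And>s. F s * s \<le> 0"
begin

lemma coord_in_ball: "norm x \<le> r \<Longrightarrow> coord x i \<in> {-r..r}"
  using abs_coord_le_norm[of x i] by (auto simp: abs_le_iff)

lemma coord_pointwise [simp]: "coord (pointwise F x) i = F (coord x i)"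
proof -
  obtain L where L: "L-lipschitz_on {-norm x..norm x} F" using loc_lip by blast
  have "\<bar>F (coord x i)\<bar> \<le> L * \<bar>coord x i\<bar>" for i
    using lipschitz_onD[OF L coord_in_ball, of x 0 i] by (simp add: dist_real_def F_0)
  from square_summable_dominated[OF this] show ?thesis
    by (simp add: pointwise_def Abs_ell2_inverse)
qed

lemma coord_field:
  "bij p \<Longrightarrow> coord (field \<nu> lam F p x) i =
     \<nu> * (coord x (inv p i) - 2 * coord x i + coord x (p i)) - lam * coord x i + F (coord x i)"
  by (simp add: field_def bij_imp_bij_inv algebra_simps)

lemma field_lipschitz:
  assumes "bij p" "L-lipschitz_on {-r..r} F" "norm x \<le> r" "norm y \<le> r"
  shows "norm (field \<nu> lam F p x - field \<nu> lam F p y) \<le> (4 * \<nu> + lam + L) * norm (x - y)"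
proof -
  have q: "bij (inv p)" by (rule bij_imp_bij_inv[OF assms(1)])
  have 1: "norm (pointwise F x - pointwise F y) \<le> L * norm (x - y)"
    using lipschitz_on_nonneg[OF assms(2)]
    by (rule norm_le_of_coord_le)
      (use lipschitz_onD[OF assms(2) coord_in_ball[OF assms(3)] coord_in_ball[OF assms(4)]]
        in \<open>simp add: dist_real_def\<close>)
  have eq: "field \<nu> lam F p x - field \<nu> lam F p y =
      \<nu> *\<^sub>R (permute p (x - y) + permute (inv p) (x - y) - 2 *\<^sub>R (x - y)) - lam *\<^sub>R (x - y)
      + (pointwise F x - pointwise F y)"
    by (simp add: field_def permute_diff assms(1) q algebra_simps)
  have "norm (permute p (x - y) + permute (inv p) (x - y) - 2 *\<^sub>R (x - y)) \<le> 4 * norm (x - y)"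
    using norm_triangle_ineq4[of "permute p (x - y) + permute (inv p) (x - y)" "2 *\<^sub>R (x - y)"]
      norm_triangle_ineq[of "permute p (x - y)" "permute (inv p) (x - y)"]
    by (simp add: norm_permute assms(1) q)
  then have 2: "norm (\<nu> *\<^sub>R (permute p (x - y) + permute (inv p) (x - y) - 2 *\<^sub>R (x - y)))
      \<le> 4 * \<nu> * norm (x - y)"
    using nu_pos by simp
  have 3: "norm (lam *\<^sub>R (x - y)) = lam * norm (x - y)" using lam_pos by simp
  show ?thesis
    unfolding eq using 1 2 3
    norm_triangle_ineq[of "\<nu> *\<^sub>R (permute p (x - y) + permute (inv p) (x - y) - 2 *\<^sub>R (x - y)) - lam *\<^sub>R (x - y)"
        "pointwise F x - pointwise F y"]
    norm_triangle_ineq4[of "\<nu> *\<^sub>R (permute p (x - y) + permute (inv p) (x - y) - 2 *\<^sub>R (x - y))" "lam *\<^sub>R (x - y)"]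
    by (simp only: distrib_right)
qed

text \<open>Pointwise, \<open>2 x (p i) x i \<le> (x i)\<^sup>2 + (x (p i))\<^sup>2\<close>. After
  reindexing by \<open>p\<close>, the second term is the weighted energy again, except that the
  weight has moved by one step, which costs \<open>\<delta>\<close>.\<close>

lemma inner_weigh_permute_le:
  assumes "bij p" "weight \<theta>" "\<And>i. \<bar>\<theta> (p i) - \<theta> i\<bar> \<le> \<delta>"
  shows "2 * inner (weigh \<theta> x) (permute p x) \<le> 2 * inner (weigh \<theta> x) x + \<delta> * (norm x)\<^sup>2"
proof -
  have "inner (weigh \<theta> x) (2 *\<^sub>R permute p x) \<le>
      inner (weigh \<theta> x) x + inner (weigh \<theta> (permute p x)) (permute p x)"
    unfolding inner_ell2_def
  proof (subst infsum_add[symmetric], (rule coord_mult_summable)+, rule infsum_mono)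
    fix i
    have "\<theta> i * (2 * (coord x i * coord x (p i))) \<le> \<theta> i * ((coord x i)\<^sup>2 + (coord x (p i))\<^sup>2)"
      using assms(2) sum_squares_bound[of "coord x i" "coord x (p i)"]
      by (intro mult_left_mono) (auto simp: weight_def)
    then show "coord (weigh \<theta> x) i * coord (2 *\<^sub>R permute p x) i
        \<le> coord (weigh \<theta> x) i * coord x i + coord (weigh \<theta> (permute p x)) i * coord (permute p x) i"
      using assms(1,2) by (simp add: power2_eq_square algebra_simps)
  qed (intro coord_mult_summable summable_on_add)+
  also have "inner (weigh \<theta> (permute p x)) (permute p x)
      \<le> inner (permute p (weigh \<theta> x)) (permute p x) + inner (\<delta> *\<^sub>R permute p x) (permute p x)"
    unfolding inner_add_left[symmetric]
  proof (rule inner_mono_coord)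
    fix i
    have "\<theta> i * (coord x (p i))\<^sup>2 \<le> (\<theta> (p i) + \<delta>) * (coord x (p i))\<^sup>2"
      using assms(3)[of i] by (intro mult_right_mono) auto
    then show "coord (weigh \<theta> (permute p x)) i * coord (permute p x) i
        \<le> coord (permute p (weigh \<theta> x) + \<delta> *\<^sub>R permute p x) i * coord (permute p x) i"
      using assms(1,2) by (simp add: power2_eq_square algebra_simps)
  qed
  also have "\<dots> = inner (weigh \<theta> x) x + \<delta> * (norm x)\<^sup>2"
    by (simp add: inner_permute assms(1) power2_norm_eq_inner)
  finally show ?thesis by simp
qed

text \<open>The coupling contributes at most the error \<open>\<delta>\<close> from moving the weight along
  \<open>p\<close> and along its inverse; the sign condition on \<open>F\<close> acts coordinate
  by coordinate and so survives any weight; half of the damping absorbs the forcing.\<close>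

lemma weighted_dissipation:
  assumes "bij p" "weight \<theta>" "\<And>i. \<bar>\<theta> (p i) - \<theta> i\<bar> \<le> \<delta>"
  shows "2 * inner (weigh \<theta> x) (field \<nu> lam F p x + h)
    \<le> - lam * inner (weigh \<theta> x) x + (2 * \<nu> * \<delta> * (norm x)\<^sup>2 + inner (weigh \<theta> h) h / lam)"
proof -
  have q: "bij (inv p)" by (rule bij_imp_bij_inv[OF assms(1)])
  have "\<bar>\<theta> (inv p i) - \<theta> i\<bar> \<le> \<delta>" for i
    using assms(3)[of "inv p i"] assms(1) by (simp add: bij_inv_eq_iff surj_f_inv_f bij_is_surj abs_minus_commute)
  from inner_weigh_permute_le[OF q assms(2) this] inner_weigh_permute_le[OF assms]
  have "2 * inner (weigh \<theta> x) (permute p x + permute (inv p) x - 2 *\<^sub>R x) \<le> 2 * (\<delta> * (norm x)\<^sup>2)"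
    by (simp add: inner_add_right inner_diff_right) (smt (verit))
  then have "\<nu> * (2 * inner (weigh \<theta> x) (permute p x + permute (inv p) x - 2 *\<^sub>R x)) \<le> \<nu> * (2 * (\<delta> * (norm x)\<^sup>2))"
    using nu_pos by simp
  then have 1: "2 * inner (weigh \<theta> x) (\<nu> *\<^sub>R (permute p x + permute (inv p) x - 2 *\<^sub>R x)) \<le> 2 * \<nu> * \<delta> * (norm x)\<^sup>2"
    by (simp add: algebra_simps)
  have 2: "inner (weigh \<theta> x) (pointwise F x) \<le> inner 0 (0::ell2)"
  proof (rule inner_mono_coord)
    fix i
    have "\<theta> i * (F (coord x i) * coord x i) \<le> 0"
      using assms(2) by (intro mult_nonneg_nonpos F_sign) (simp add: weight_def)
    then show "coord (weigh \<theta> x) i * coord (pointwise F x) i \<le> coord 0 i * coord 0 i"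
      using assms(2) by (simp add: algebra_simps)
  qed
  have 3: "inner (weigh \<theta> x) (2 *\<^sub>R h) \<le> inner (weigh \<theta> x) (lam *\<^sub>R x) + inner (weigh \<theta> h) ((1/lam) *\<^sub>R h)"
    unfolding inner_ell2_def
  proof (subst infsum_add[symmetric], (rule coord_mult_summable)+, rule infsum_mono)
    fix i
    have "2 * (coord x i * coord h i) \<le> lam * (coord x i)\<^sup>2 + (coord h i)\<^sup>2 / lam"
      using zero_le_power2[of "lam * coord x i - coord h i"] lam_pos
      by (simp add: field_simps power2_eq_square)
    then have "\<theta> i * (2 * (coord x i * coord h i)) \<le> \<theta> i * (lam * (coord x i)\<^sup>2 + (coord h i)\<^sup>2 / lam)"
      using assms(2) by (intro mult_left_mono) (auto simp: weight_def)
    then show "coord (weigh \<theta> x) i * coord (2 *\<^sub>R h) i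
        \<le> coord (weigh \<theta> x) i * coord (lam *\<^sub>R x) i + coord (weigh \<theta> h) i * coord ((1/lam) *\<^sub>R h) i"
      using assms(2) by (simp add: power2_eq_square algebra_simps)
  qed (intro coord_mult_summable summable_on_add)+
  show ?thesis
    using 1 2 3 by (simp add: field_def inner_add_right inner_diff_right)
qed

lemma weighted_energy_decay:
  assumes u: "solves \<nu> lam F p g v u" and p: "bij p" and \<theta>: "weight \<theta>" "\<And>i. \<bar>\<theta> (p i) - \<theta> i\<bar> \<le> \<delta>"
    and B: "\<And>t. 0 \<le> t \<Longrightarrow> \<delta> * (norm (u t))\<^sup>2 \<le> \<delta> * B"
    and G: "\<And>t. 0 \<le> t \<Longrightarrow> inner (weigh \<theta> (g t)) (g t) \<le> G"
    and "0 \<le> t"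
  shows "inner (weigh \<theta> (u t)) (u t) \<le> exp (- lam * t) * inner (weigh \<theta> v) v + (2 * \<nu> * \<delta> * B + G / lam) / lam"
proof -
  let ?c = "2 * \<nu> * \<delta> * B + G / lam"
  let ?E = "\<lambda>t. inner (weigh \<theta> (u t)) (u t)"
  have "0 \<le> \<delta> * B" using B[of 0] \<theta>(2)[of 0] by (smt (verit) mult_nonneg_nonneg zero_le_power2)
  moreover have "0 \<le> G"
  proof -
    have "inner 0 (0::ell2) \<le> inner (weigh \<theta> (g 0)) (g 0)"
      by (rule inner_mono_coord) (use \<theta>(1) in \<open>simp add: mult.assoc\<close>, simp add: weight_def)
    then show ?thesis using G[of 0] by simp
  qed
  ultimately have c: "0 \<le> ?c" using nu_pos lam_pos by (simp add: mult.assoc)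
  have "?E t \<le> exp (- lam * t) * (?E 0 + ?c / - lam) - ?c / - lam"
  proof (rule differential_inequality)
    fix t :: real assume t: "0 \<le> t"
    have d: "(u has_vector_derivative (field \<nu> lam F p (u t) + g t)) (at t within {0..})"
      using u t unfolding solves_def by blast
    have "((\<lambda>t. inner (weigh \<theta> (u t)) (u t)) has_vector_derivative
        inner (weigh \<theta> (u t)) (field \<nu> lam F p (u t) + g t)
        + inner (weigh \<theta> (field \<nu> lam F p (u t) + g t)) (u t)) (at t within {0..})"
      by (rule bounded_bilinear.has_vector_derivative[OF bounded_bilinear_inner
            bounded_linear.has_vector_derivative[OF bounded_linear_weigh[OF \<theta>(1)] d] d])
    moreover have "inner (weigh \<theta> h) x = inner (weigh \<theta> x) h" for x h
      unfolding inner_ell2_def by (rule infsum_cong) (simp add: \<theta>(1))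
    ultimately show "(?E has_real_derivative 2 * inner (weigh \<theta> (u t)) (field \<nu> lam F p (u t) + g t))
        (at t within {0..})"
      by (simp add: has_real_derivative_iff_has_vector_derivative)
    have "2 * inner (weigh \<theta> (u t)) (field \<nu> lam F p (u t) + g t)
       \<le> - lam * ?E t + (2 * \<nu> * \<delta> * (norm (u t))\<^sup>2 + inner (weigh \<theta> (g t)) (g t) / lam)"
      by (rule weighted_dissipation[OF p \<theta>])
    also have "\<dots> \<le> - lam * ?E t + ?c"
      using mult_left_mono[OF B[OF t], of "2 * \<nu>"] G[OF t] nu_pos lam_pos
      by (intro add_left_mono add_mono divide_right_mono) (auto simp: mult.assoc)
    finally show "2 * inner (weigh \<theta> (u t)) (field \<nu> lam F p (u t) + g t) \<le> - lam * ?E t + ?c" .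
  qed (use lam_pos \<open>0 \<le> t\<close> in auto)
  also have "\<dots> = exp (- lam * t) * ?E 0 + ?c / lam - exp (- lam * t) * (?c / lam)"
    by (simp add: algebra_simps)
  also have "\<dots> \<le> exp (- lam * t) * ?E 0 + ?c / lam"
  proof -
    have "0 \<le> exp (- lam * t) * (?c / lam)" using c lam_pos by (intro mult_nonneg_nonneg divide_nonneg_pos) auto
    then show ?thesis by linarith
  qed
  finally show ?thesis using u by (simp add: solves_def)
qed

text \<open>A constant weight does not move under \<open>p\<close>, so the coupling causes no error.\<close>

lemma norm_decay:
  assumes u: "solves \<nu> lam F p g v u" and p: "bij p"
    and g: "\<And>t. 0 \<le> t \<Longrightarrow> norm (g t) \<le> C" and "0 \<le> t"
  shows "(norm (u t))\<^sup>2 \<le> exp (- lam * t) * (norm v)\<^sup>2 + (C / lam)\<^sup>2"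
proof -
  have w: "weigh (\<lambda>_. 1) x = x" for x
    by (rule ell2_eqI) (simp add: weight_def)
  have "(norm (u t))\<^sup>2 \<le> exp (- lam * t) * (norm v)\<^sup>2 + (2 * \<nu> * 0 * 0 + C\<^sup>2 / lam) / lam"
    using weighted_energy_decay[OF u p, of "\<lambda>_. 1" 0 0 "C\<^sup>2" t] g \<open>0 \<le> t\<close>
    by (simp add: weight_def w power2_norm_eq_inner[symmetric] power_mono)
  then show ?thesis by (simp add: power2_eq_square)
qed

lemma norm_bounded:
  assumes u: "solves \<nu> lam F p g v u" and p: "bij p"
    and g: "\<And>t. 0 \<le> t \<Longrightarrow> norm (g t) \<le> C" and "0 \<le> t"
  shows "norm (u t) \<le> norm v + C / lam"
proof (rule power2_le_imp_le)
  have C: "0 \<le> C" using g[of 0] norm_ge_zero[of "g 0"] by linarith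
  have "(norm (u t))\<^sup>2 \<le> exp (- lam * t) * (norm v)\<^sup>2 + (C / lam)\<^sup>2"
    by (rule norm_decay[OF u p g \<open>0 \<le> t\<close>])
  also have "\<dots> \<le> 1 * (norm v)\<^sup>2 + (C / lam)\<^sup>2"
    using lam_pos \<open>0 \<le> t\<close> by (intro add_right_mono mult_right_mono) auto
  also have "\<dots> \<le> (norm v + C / lam)\<^sup>2"
    using C lam_pos by (simp add: power2_sum)
  finally show "(norm (u t))\<^sup>2 \<le> (norm v + C / lam)\<^sup>2" .
  show "0 \<le> norm v + C / lam" using C lam_pos by simp
qed

end

section \<open>Tails of solutions\<close>

text \<open>Vanishes for \<open>\<bar>i\<bar> \<le> N\<close>, equals \<open>1\<close> for
  \<open>\<bar>i\<bar> > 2 N\<close> and has slope \<open>1 / (N + 1)\<close> in between; the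
  slope is what the coupling error is proportional to.\<close>

definition cutoff :: "nat \<Rightarrow> int \<Rightarrow> real" where
  "cutoff N i = min 1 (max 0 ((\<bar>real_of_int i\<bar> - real N) / real (Suc N)))"

lemma weight_cutoff: "weight (cutoff N)"
  by (auto simp: weight_def cutoff_def)

lemma cutoff_lipschitz:
  assumes "\<bar>\<bar>j\<bar> - \<bar>i\<bar>\<bar> \<le> 1"
  shows "\<bar>cutoff N j - cutoff N i\<bar> \<le> 1 / real (Suc N)"
proof -
  have "\<bar>\<bar>real_of_int j\<bar> - \<bar>real_of_int i\<bar>\<bar> \<le> 1" using assms by linarith
  then have "\<bar>(\<bar>real_of_int j\<bar> - real N) / real (Suc N) - (\<bar>real_of_int i\<bar> - real N) / real (Suc N)\<bar> \<le> 1 / real (Suc N)"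
    unfolding diff_divide_distrib[symmetric] abs_divide by (simp add: divide_right_mono)
  then show ?thesis unfolding cutoff_def by linarith
qed

lemma cutoff_eq_0:
  assumes "\<bar>i\<bar> \<le> int N" shows "cutoff N i = 0"
proof -
  have "\<bar>real_of_int i\<bar> \<le> real N" using assms by linarith
  then have "(\<bar>real_of_int i\<bar> - real N) / real (Suc N) \<le> 0" by (intro divide_nonpos_pos) auto
  then show ?thesis unfolding cutoff_def by linarith
qed

lemma cutoff_eq_1:
  assumes "\<bar>i\<bar> > int (2 * N)" shows "cutoff N i = 1"
proof -
  have "\<bar>real_of_int i\<bar> - real N \<ge> real (Suc N)" using assms by linarith
  then have "(\<bar>real_of_int i\<bar> - real N) / real (Suc N) \<ge> 1" by (simp only: le_divide_eq_1_pos of_nat_0_less_iff zero_less_Suc)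
  then show ?thesis unfolding cutoff_def by linarith
qed

lemma tail_square_inner: "(tail N x)\<^sup>2 = inner (x - trunc N x) (x - trunc N x)"
  by (simp add: tail_def power2_norm_eq_inner)

lemma inner_cutoff_le: "inner (weigh (cutoff N) x) x \<le> (tail N x)\<^sup>2"
  unfolding tail_square_inner
proof (rule inner_mono_coord)
  fix i
  have "cutoff N i * (coord x i)\<^sup>2 \<le> 1 * (coord x i)\<^sup>2"
    using weight_cutoff[of N] by (intro mult_right_mono) (auto simp: weight_def)
  then show "coord (weigh (cutoff N) x) i * coord x i \<le> coord (x - trunc N x) i * coord (x - trunc N x) i"
    by (cases "\<bar>i\<bar> \<le> int N")
     (simp_all add: weight_cutoff cutoff_eq_0 trunc.rep_eq power2_eq_square mult.assoc)
qed

lemma tail_le_inner_cutoff: "(tail (2 * N) x)\<^sup>2 \<le> inner (weigh (cutoff N) x) x"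
  unfolding tail_square_inner
proof (rule inner_mono_coord)
  fix i
  have "0 \<le> cutoff N i" using weight_cutoff[of N] by (auto simp: weight_def)
  then show "coord (x - trunc (2 * N) x) i * coord (x - trunc (2 * N) x) i \<le> coord (weigh (cutoff N) x) i * coord x i"
    by (cases "\<bar>i\<bar> \<le> int (2 * N)")
     (simp_all add: weight_cutoff cutoff_eq_1 trunc.rep_eq mult.assoc)
qed

text \<open>The condition that makes a cut-off in \<open>\<bar>i\<bar>\<close> nearly invariant. The cyclic
  shift of \<open>{- n..n}\<close> satisfies it with the same constant as \<open>i \<mapsto> i +
  1\<close>, since \<open>\<bar>- n\<bar> = \<bar>n\<bar>\<close>.\<close>

definition near_shift :: "(int \<Rightarrow> int) \<Rightarrow> bool" where
  "near_shift p \<longleftrightarrow> bij p \<and> (\<forall>i. \<bar>\<bar>p i\<bar> - \<bar>i\<bar>\<bar> \<le> 1)"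

context dissipative_lattice begin

text \<open>The cut-off energy lies between the squared tails at \<open>2 N\<close> and at
  \<open>N\<close>, which is why the index doubles.\<close>

lemma tail_decay:
  assumes u: "solves \<nu> lam F p g v u" and p: "near_shift p"
    and B: "\<And>t. 0 \<le> t \<Longrightarrow> (norm (u t))\<^sup>2 \<le> B"
    and g: "\<And>t. 0 \<le> t \<Longrightarrow> tail N (g t) \<le> \<gamma>" and "0 \<le> t"
  shows "(tail (2 * N) (u t))\<^sup>2 \<le>
    exp (- lam * t) * (tail N v)\<^sup>2 + (2 * \<nu> * (1 / real (Suc N)) * B + \<gamma>\<^sup>2 / lam) / lam"
proof -
  have "(tail (2 * N) (u t))\<^sup>2 \<le> inner (weigh (cutoff N) (u t)) (u t)" by (rule tail_le_inner_cutoff)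
  also have "\<dots> \<le> exp (- lam * t) * inner (weigh (cutoff N) v) v
      + (2 * \<nu> * (1 / real (Suc N)) * B + \<gamma>\<^sup>2 / lam) / lam"
  proof (rule weighted_energy_decay[OF u _ weight_cutoff])
    show "inner (weigh (cutoff N) (g t)) (g t) \<le> \<gamma>\<^sup>2" if "0 \<le> t" for t
      using inner_cutoff_le[of N "g t"] power_mono[OF g[OF that] tail_nonneg, of 2] by linarith
    show "\<bar>cutoff N (p i) - cutoff N i\<bar> \<le> 1 / real (Suc N)" for i
      using p by (intro cutoff_lipschitz) (simp add: near_shift_def)
  qed (use p B \<open>0 \<le> t\<close> in \<open>auto simp: near_shift_def intro!: mult_left_mono divide_right_mono\<close>)
  also have "exp (- lam * t) * inner (weigh (cutoff N) v) v \<le> exp (- lam * t) * (tail N v)\<^sup>2"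
    by (intro mult_left_mono inner_cutoff_le) simp
  finally show ?thesis by simp
qed

end

section \<open>Comparison of two solutions\<close>

context dissipative_lattice begin

text \<open>If the second solution satisfies the first equation up to a residual \<open>\<eta>\<close>,
  Gronwall's inequality bounds the distance. The residual \<open>0\<close> gives uniqueness and
  continuity in the initial value; a small residual compares a periodic approximation with the
  lattice.\<close>

lemma perturbation_estimate:
  assumes u: "solves \<nu> lam F p g v u" and w: "solves \<nu> lam F q h v' w" and p: "bij p"
    and L: "L-lipschitz_on {-r..r} F"
    and ur: "\<And>t. 0 \<le> t \<Longrightarrow> norm (u t) \<le> r" and wr: "\<And>t. 0 \<le> t \<Longrightarrow> norm (w t) \<le> r"
    and res: "\<And>t. 0 \<le> t \<Longrightarrow> norm ((field \<nu> lam F p (w t) + g t) - (field \<nu> lam F q (w t) + h t)) \<le> \<eta>"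
    and "0 \<le> t"
  shows "(norm (u t - w t))\<^sup>2 \<le> exp ((2 * (4 * \<nu> + lam + L) + 1) * t) * ((norm (v - v'))\<^sup>2 + \<eta>\<^sup>2)"
proof -
  define M where "M = 4 * \<nu> + lam + L"
  let ?K = "2 * M + 1"
  have M: "0 \<le> M" using nu_pos lam_pos lipschitz_on_nonneg[OF L] by (simp add: M_def)
  let ?y = "\<lambda>t. inner (u t - w t) (u t - w t)"
  let ?d = "\<lambda>t. (field \<nu> lam F p (u t) + g t) - (field \<nu> lam F q (w t) + h t)"
  have "?y t \<le> exp (?K * t) * (?y 0 + \<eta>\<^sup>2 / ?K) - \<eta>\<^sup>2 / ?K"
  proof (rule differential_inequality)
    fix t :: real assume t: "0 \<le> t"
    have d: "((\<lambda>t. u t - w t) has_vector_derivative ?d t) (at t within {0..})"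
      using u w t unfolding solves_def by (intro has_vector_derivative_diff) auto
    show "(?y has_real_derivative 2 * inner (u t - w t) (?d t)) (at t within {0..})"
      using bounded_bilinear.has_vector_derivative[OF bounded_bilinear_inner d d]
      by (simp add: has_real_derivative_iff_has_vector_derivative inner_commute)
    define x where "x = norm (u t - w t)"
    have "norm (?d t) \<le> norm (field \<nu> lam F p (u t) - field \<nu> lam F p (w t))
       + norm ((field \<nu> lam F p (w t) + g t) - (field \<nu> lam F q (w t) + h t))"
      by (rule order_trans[OF _ norm_triangle_ineq]) (simp add: algebra_simps)
    also have "\<dots> \<le> M * x + \<eta>"
      unfolding M_def x_def by (intro add_mono field_lipschitz[OF p L] ur wr res t)
    finally have "inner (u t - w t) (?d t) \<le> x * (M * x + \<eta>)"
      using norm_cauchy_schwarz[of "u t - w t" "?d t"] unfolding x_def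
      by (meson mult_left_mono norm_ge_zero order_trans)
    then have "2 * inner (u t - w t) (?d t) \<le> 2 * M * x\<^sup>2 + 2 * x * \<eta>"
      by (simp add: algebra_simps power2_eq_square)
    also have "\<dots> \<le> ?K * x\<^sup>2 + \<eta>\<^sup>2"
      using sum_squares_bound[of x \<eta>] by (simp add: algebra_simps)
    finally show "2 * inner (u t - w t) (?d t) \<le> ?K * ?y t + \<eta>\<^sup>2"
      by (simp add: x_def power2_norm_eq_inner)
  qed (use M \<open>0 \<le> t\<close> in auto)
  also have "\<dots> \<le> exp (?K * t) * (?y 0 + \<eta>\<^sup>2 / ?K)" using M by simp
  also have "\<dots> \<le> exp (?K * t) * (?y 0 + \<eta>\<^sup>2)"
  proof -
    have "\<eta>\<^sup>2 / ?K \<le> \<eta>\<^sup>2 / 1" using M by (intro divide_left_mono) auto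
    then show ?thesis by (intro mult_left_mono add_left_mono) auto
  qed
  finally show ?thesis
    using u w by (simp add: solves_def power2_norm_eq_inner M_def)
qed

end

text \<open>Coordinates that both permutations fetch from \<open>{- m..m}\<close> cancel, and what is left
  consists of two rearrangements of the tail.\<close>

lemma permute_agree:
  assumes "bij p" "bij q" "\<And>i. \<bar>p i\<bar> \<le> int m \<or> \<bar>q i\<bar> \<le> int m \<Longrightarrow> p i = q i"
  shows "norm (permute p x - permute q x) \<le> 2 * tail m x"
proof -
  have "permute p x - permute q x = permute p (x - trunc m x) - permute q (x - trunc m x)"
  proof (rule ell2_eqI)
    fix i
    show "coord (permute p x - permute q x) i
        = coord (permute p (x - trunc m x) - permute q (x - trunc m x)) i"
      using assms(3)[of i]
      by (cases "\<bar>p i\<bar> \<le> int m"; cases "\<bar>q i\<bar> \<le> int m") (simp_all add: assms(1,2) trunc.rep_eq)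
  qed
  then show ?thesis
    using norm_triangle_ineq4[of "permute p (x - trunc m x)" "permute q (x - trunc m x)"]
    by (simp add: norm_permute assms(1,2) tail_def)
qed

lemma field_agree:
  assumes p: "bij p" and q: "bij q" and "0 \<le> \<nu>"
    and agree: "\<And>i. \<bar>i\<bar> \<le> int m \<Longrightarrow> p i = q i \<and> inv p i = inv q i"
  shows "norm (field \<nu> lam F p x - field \<nu> lam F q x) \<le> 4 * \<nu> * tail m x"
proof -
  have p': "p (inv p i) = i" "inv p (p i) = i" and q': "q (inv q i) = i" "inv q (q i) = i" for i
    using p q by (simp_all add: bij_is_surj surj_f_inv_f bij_is_inj)
  have 1: "norm (permute p x - permute q x) \<le> 2 * tail m x"
    by (rule permute_agree[OF p q]) (metis agree p' q')
  have 2: "norm (permute (inv p) x - permute (inv q) x) \<le> 2 * tail m x"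
    by (rule permute_agree[OF bij_imp_bij_inv[OF p] bij_imp_bij_inv[OF q]]) (metis agree p' q')
  have "field \<nu> lam F p x - field \<nu> lam F q x =
      \<nu> *\<^sub>R ((permute p x - permute q x) + (permute (inv p) x - permute (inv q) x))"
    by (simp add: field_def algebra_simps)
  also have "norm \<dots> \<le> \<nu> * (2 * tail m x + 2 * tail m x)"
    using \<open>0 \<le> \<nu>\<close> norm_triangle_le[OF add_mono[OF 1 2]] by (simp add: mult_left_mono)
  finally show ?thesis by simp
qed

section \<open>Existence of solutions\<close>

lemma integral_has_vector_derivative_Ici:
  fixes k :: "real \<Rightarrow> 'a::banach"
  assumes "continuous_on {0..} k" "0 \<le> t"
  shows "((\<lambda>t. integral {0..t} k) has_vector_derivative k t) (at t within {0..})"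
proof -
  have "((\<lambda>t. integral {0..t} k) has_vector_derivative k t) (at t within {0..t+1})"
    by (rule integral_has_vector_derivative[OF continuous_on_subset[OF assms(1)]])
      (use assms(2) in auto)
  moreover have "at t within {0..t+1} = at t within {0..}"
    by (rule at_within_nhd[of t "{..<t+1}"]) auto
  ultimately show ?thesis by simp
qed

text \<open>Integration against \<open>exp (K s)\<close> gains the factor \<open>1 / K\<close>, which makes
  the Picard operator a contraction in the weighted norm.\<close>

lemma norm_integral_le_exp:
  fixes k :: "real \<Rightarrow> 'a::banach"
  assumes k: "continuous_on {0..} k" and "0 < K" "0 \<le> A"
    and le: "\<And>s. 0 \<le> s \<Longrightarrow> norm (k s) \<le> A * exp (K * s)" and "0 \<le> t"
  shows "norm (integral {0..t} k) \<le> A / K * exp (K * t)"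
proof -
  have I: "((\<lambda>s. A * exp (K * s)) has_integral (A / K * exp (K * t) - A / K * exp (K * 0))) {0..t}"
    using \<open>0 < K\<close>
    by (intro fundamental_theorem_of_calculus \<open>0 \<le> t\<close>)
      (auto intro!: derivative_eq_intros simp: has_real_derivative_iff_has_vector_derivative[symmetric])
  have "norm (integral {0..t} k) \<le> integral {0..t} (\<lambda>s. A * exp (K * s))"
  proof (rule Henstock_Kurzweil_Integration.integral_norm_bound_integral)
    show "k integrable_on {0..t}"
      by (rule integrable_continuous_interval[OF continuous_on_subset[OF k]]) auto
    show "(\<lambda>s. A * exp (K * s)) integrable_on {0..t}" using I by blast
  qed (use le in auto)
  also have "\<dots> = A / K * exp (K * t) - A / K" using integral_unique[OF I] by simp
  also have "\<dots> \<le> A / K * exp (K * t)" using assms by simp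
  finally show ?thesis .
qed

text \<open>The Picard operator is a contraction on the whole half-line at once if curves are weighted by
  \<open>exp (- K t)\<close> with \<open>K\<close> above the Lipschitz constant; the weighted
  curves are bounded, so the fixed point lives in a space of bounded continuous functions and no
  continuation argument arises.\<close>

lemma lipschitz_ode_solution:
  fixes G :: "'a::banach \<Rightarrow> 'a" and g :: "real \<Rightarrow> 'a"
  assumes G: "L-lipschitz_on UNIV G" and g: "continuous_on {0..} g"
    and C: "\<And>t. 0 \<le> t \<Longrightarrow> norm (g t) \<le> C"
  obtains u where "u 0 = v"
    "\<And>t. 0 \<le> t \<Longrightarrow> (u has_vector_derivative (G (u t) + g t)) (at t within {0..})"
proof -
  \<comment> \<open>Any constant above \<open>L\<close> serves as exponent; the contraction factor is \<open>L / K\<close>.\<close>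
  define K where "K = L + 1"
  have "0 \<le> L" by (rule lipschitz_on_nonneg[OF G])
  then have K: "0 < K" "L / K < 1" "0 \<le> L / K" by (auto simp: K_def)
  have "0 \<le> C" using C[of 0] norm_ge_zero[of "g 0"] by linarith
  define k where "k z s = G (exp (K * s) *\<^sub>R apply_bcontfun z s) + g s" for z :: "real \<Rightarrow>\<^sub>C 'a" and s
  have contG: "continuous_on UNIV G" by (rule lipschitz_on_continuous_on[OF G])
  have k: "continuous_on {0..} (k z)" for z
    unfolding k_def
    by (intro continuous_intros g continuous_on_compose2[OF contG]) auto
  define I where "I z t = v + integral {0..t} (k z)" for z t
  have dI: "(I z has_vector_derivative k z t) (at t within {0..})" if "0 \<le> t" for z t
    unfolding I_def using integral_has_vector_derivative_Ici[OF k that]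
    by (auto intro!: derivative_eq_intros)
  then have contI: "continuous_on {0..} (I z)" for z
    by (auto simp: continuous_on_eq_continuous_within intro: has_vector_derivative_continuous)
  \<comment> \<open>Curves on the half-line are extended to negative times by their value at \<open>0\<close>.\<close>
  define \<Phi> where "\<Phi> z t = exp (- K * max 0 t) *\<^sub>R I z (max 0 t)" for z t
  have dist_k: "norm (k z s - k z' s) \<le> L * dist z z' * exp (K * s)" for z z' s
  proof -
    have "norm (k z s - k z' s) \<le> L * dist (exp (K * s) *\<^sub>R apply_bcontfun z s) (exp (K * s) *\<^sub>R apply_bcontfun z' s)"
      using lipschitz_onD[OF G] by (simp add: k_def dist_norm)
    also have "\<dots> = L * (exp (K * s) * dist (apply_bcontfun z s) (apply_bcontfun z' s))"
      by (simp add: dist_norm scaleR_diff_right[symmetric])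
    also have "\<dots> \<le> L * (exp (K * s) * dist z z')"
      using \<open>0 \<le> L\<close> by (intro mult_left_mono dist_bounded) auto
    finally show ?thesis by (simp add: mult_ac)
  qed
  have "\<Phi> z \<in> bcontfun" for z
  proof -
    have "continuous_on UNIV (\<Phi> z)"
      unfolding \<Phi>_def
      by (intro continuous_intros continuous_on_compose2[OF contI]) auto
    moreover have "norm (\<Phi> z t) \<le> norm v + (L * norm z + norm (G 0) + C) / K" for t
    proof -
      define \<tau> where "\<tau> = max 0 t"
      have "0 \<le> \<tau>" by (simp add: \<tau>_def)
      have "norm (k z s) \<le> (L * norm z + norm (G 0) + C) * exp (K * s)" if "0 \<le> s" for s
      proof -
        have e: "1 \<le> exp (K * s)" using K that by simp
        have "norm (k z s) \<le> norm (k z s - k 0 s) + norm (k 0 s)"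
          by (metis diff_add_cancel norm_triangle_ineq)
        also have "norm (k 0 s) \<le> norm (G 0) + C"
          using C[OF that] norm_triangle_ineq[of "G 0" "g s"] by (simp add: k_def)
        also have "norm (k z s - k 0 s) \<le> L * norm z * exp (K * s)"
          using dist_k[of z s 0] by (simp add: dist_norm)
        finally show ?thesis
          using mult_left_mono[OF e, of "norm (G 0) + C"] \<open>0 \<le> C\<close> by (simp add: algebra_simps)
      qed
      from norm_integral_le_exp[OF k K(1) _ this \<open>0 \<le> \<tau>\<close>]
      have i: "norm (integral {0..\<tau>} (k z)) \<le> (L * norm z + norm (G 0) + C) / K * exp (K * \<tau>)"
        using \<open>0 \<le> L\<close> \<open>0 \<le> C\<close> by simp
      have "norm (\<Phi> z t) = exp (- K * \<tau>) * norm (I z \<tau>)"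
        by (simp add: \<Phi>_def \<tau>_def)
      also have "\<dots> \<le> exp (- K * \<tau>) * (norm v + (L * norm z + norm (G 0) + C) / K * exp (K * \<tau>))"
        unfolding I_def using i
        by (intro mult_left_mono norm_triangle_le add_left_mono) auto
      also have "\<dots> = exp (- K * \<tau>) * norm v + (L * norm z + norm (G 0) + C) / K * (exp (- K * \<tau>) * exp (K * \<tau>))"
        by (simp add: algebra_simps)
      also have "\<dots> = exp (- K * \<tau>) * norm v + (L * norm z + norm (G 0) + C) / K"
        by (simp add: exp_add[symmetric])
      also have "exp (- K * \<tau>) * norm v \<le> 1 * norm v"
        using K \<open>0 \<le> \<tau>\<close> by (intro mult_right_mono) auto
      finally show ?thesis by simp
    qed
    then have "bounded (range (\<Phi> z))" by (auto simp: bounded_iff)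
    ultimately show ?thesis by (simp add: bcontfun_def)
  qed
  then have app: "apply_bcontfun (Bcontfun (\<Phi> z)) = \<Phi> z" for z by (rule Bcontfun_inverse)
  have "dist (Bcontfun (\<Phi> z)) (Bcontfun (\<Phi> z')) \<le> L / K * dist z z'" for z z'
  proof (rule dist_bound)
    fix t :: real
    define \<tau> where "\<tau> = max 0 t"
    have "0 \<le> \<tau>" by (simp add: \<tau>_def)
    have int: "k z integrable_on {0..\<tau>}" for z
      by (rule integrable_continuous_interval[OF continuous_on_subset[OF k]]) auto
    have "norm (integral {0..\<tau>} (\<lambda>s. k z s - k z' s)) \<le> L * dist z z' / K * exp (K * \<tau>)"
      using \<open>0 \<le> L\<close> K \<open>0 \<le> \<tau>\<close>
      by (intro norm_integral_le_exp continuous_intros k dist_k) auto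
    then have i: "norm (I z \<tau> - I z' \<tau>) \<le> L * dist z z' / K * exp (K * \<tau>)"
      by (simp add: I_def integral_diff[OF int int])
    have "dist (\<Phi> z t) (\<Phi> z' t) = exp (- K * \<tau>) * norm (I z \<tau> - I z' \<tau>)"
      by (simp add: \<Phi>_def \<tau>_def dist_norm scaleR_diff_right[symmetric])
    also have "\<dots> \<le> exp (- K * \<tau>) * (L * dist z z' / K * exp (K * \<tau>))"
      using i by (intro mult_left_mono) auto
    also have "\<dots> = L / K * dist z z' * (exp (- K * \<tau>) * exp (K * \<tau>))"
      by (simp add: algebra_simps)
    also have "\<dots> = L / K * dist z z'"
      by (simp add: exp_add[symmetric])
    finally show "dist (apply_bcontfun (Bcontfun (\<Phi> z)) t) (apply_bcontfun (Bcontfun (\<Phi> z')) t) \<le> L / K * dist z z'"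
      by (simp add: app)
  qed
  then obtain z where z: "Bcontfun (\<Phi> z) = z"
    using banach_fix_type[of "L / K" "\<lambda>z. Bcontfun (\<Phi> z)"] K by blast
  have u: "exp (K * t) *\<^sub>R apply_bcontfun z t = I z t" if "0 \<le> t" for t
  proof -
    have "apply_bcontfun z t = exp (- K * t) *\<^sub>R I z t"
      using app[of z] that by (simp add: z \<Phi>_def)
    then show ?thesis by (simp add: exp_add[symmetric])
  qed
  show thesis
  proof (rule that[of "I z"])
    show "I z 0 = v" by (simp add: I_def)
    show "(I z has_vector_derivative (G (I z t) + g t)) (at t within {0..})" if "0 \<le> t" for t
      using dI[OF that, of z] by (simp add: k_def u[OF that])
  qed
qed

text \<open>\<open>F\<close> is only locally Lipschitz. Composing it with the projection onto \<open>{-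
  r..r}\<close> makes it globally Lipschitz and keeps the sign condition, hence also the a priori
  bound of \<open>norm_bounded\<close>, in which \<open>r\<close> does not occur. With that bound
  as \<open>r\<close>, the solution never sees the modification.\<close>

lemma (in dissipative_lattice) solution_exists:
  assumes p: "bij p" and g: "continuous_on UNIV g" and C: "\<And>t. norm (g t) \<le> C"
  obtains u where "solves \<nu> lam F p g v u"
proof -
  define r where "r = norm v + C / lam"
  have "0 \<le> C" using C[of 0] norm_ge_zero[of "g 0"] by linarith
  then have "0 \<le> r" using lam_pos by (simp add: r_def)
  define cl where "cl s = max (- r) (min r s)" for s
  define Fr where "Fr s = F (cl s)" for s
  have cl: "cl s \<in> {-r..r}" "\<bar>cl s - cl t\<bar> \<le> \<bar>s - t\<bar>" for s t
    using \<open>0 \<le> r\<close> by (auto simp: cl_def)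
  obtain L where L: "L-lipschitz_on {-r..r} F" using loc_lip by blast
  have Lr: "L-lipschitz_on S Fr" for S
  proof (rule lipschitz_onI)
    show "dist (Fr x) (Fr y) \<le> L * dist x y" for x y
      using lipschitz_onD[OF L cl(1) cl(1), of x y] mult_left_mono[OF cl(2)[of x y] lipschitz_on_nonneg[OF L]]
      by (simp add: Fr_def dist_real_def)
  qed (rule lipschitz_on_nonneg[OF L])
  interpret c: dissipative_lattice \<nu> lam Fr
  proof
    show "\<exists>L. L-lipschitz_on {-r..r} Fr" for r using Lr by blast
    show "Fr 0 = 0" using \<open>0 \<le> r\<close> F_0 by (simp add: Fr_def cl_def)
    show "Fr s * s \<le> 0" for s
    proof (cases "cl s = 0")
      case True then show ?thesis by (simp add: Fr_def F_0)
    next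
      case False
      then have "0 \<le> s / cl s" using \<open>0 \<le> r\<close> by (auto simp: cl_def max_def min_def zero_le_divide_iff split: if_splits)
      then have "(F (cl s) * cl s) * (s / cl s) \<le> 0" by (intro mult_nonpos_nonneg F_sign)
      then show ?thesis using False by (simp add: Fr_def)
    qed
  qed (rule nu_pos lam_pos)+
  have "(4 * \<nu> + lam + L)-lipschitz_on UNIV (field \<nu> lam Fr p)"
  proof (rule lipschitz_onI)
    show "dist (field \<nu> lam Fr p x) (field \<nu> lam Fr p y) \<le> (4 * \<nu> + lam + L) * dist x y" for x y
      unfolding dist_norm by (rule c.field_lipschitz[OF p Lr, where r = "max (norm x) (norm y)"]) auto
  qed (use nu_pos lam_pos lipschitz_on_nonneg[OF L] in simp)
  from lipschitz_ode_solution[OF this continuous_on_subset[OF g] C, of v]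
  obtain u where u: "solves \<nu> lam Fr p g v u" unfolding solves_def by (metis subset_UNIV)
  have "norm (u t) \<le> r" if "0 \<le> t" for t
    unfolding r_def by (rule c.norm_bounded[OF u p C that])
  then have "cl (coord (u t) i) = coord (u t) i" if "0 \<le> t" for t i
    using coord_in_ball[of "u t" r i] that by (auto simp: cl_def)
  then have "pointwise Fr (u t) = pointwise F (u t)" if "0 \<le> t" for t
    using that by (intro ell2_eqI) (simp add: Fr_def)
  then have "field \<nu> lam Fr p (u t) = field \<nu> lam F p (u t)" if "0 \<le> t" for t
    using that by (simp add: field_def)
  then have "solves \<nu> lam F p g v u" using u by (simp add: solves_def)
  then show thesis by (rule that)
qed

section \<open>Attraction and the Levinson center\<close>

lemma hausdorff_semidist_leI:
  assumes "\<And>a. a \<in> A \<Longrightarrow> \<exists>b\<in>B. dist a b \<le> \<epsilon>"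
  shows "hausdorff_semidist A B \<le> ennreal \<epsilon>"
  unfolding hausdorff_semidist_def
proof (rule SUP_least)
  fix a assume "a \<in> A"
  then obtain b where "b \<in> B" "dist a b \<le> \<epsilon>" using assms by blast
  then show "(INF b\<in>B. ennreal (dist a b)) \<le> ennreal \<epsilon>"
    by (intro INF_lower2[of b] ennreal_leI)
qed

lemma hausdorff_semidist_lessD:
  assumes "hausdorff_semidist A B < ennreal \<epsilon>" "a \<in> A"
  obtains b where "b \<in> B" "dist a b < \<epsilon>"
proof -
  have "(INF b\<in>B. ennreal (dist a b)) < ennreal \<epsilon>"
    using assms unfolding hausdorff_semidist_def by (meson SUP_upper le_less_trans)
  then show thesis using that by (auto simp: INF_less_iff ennreal_less_iff)
qed

lemma ennreal_tendsto_0I: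
  fixes X :: "'a \<Rightarrow> ennreal"
  assumes "\<And>\<epsilon>. 0 < \<epsilon> \<Longrightarrow> \<forall>\<^sub>F x in G. X x \<le> ennreal \<epsilon>"
  shows "(X \<longlongrightarrow> 0) G"
proof (rule order_tendstoI)
  fix a :: ennreal assume "0 < a"
  then obtain b where b: "0 < b" "b < a" using dense by blast
  then obtain \<epsilon> where "b = ennreal \<epsilon>" "0 \<le> \<epsilon>" by (cases b) auto
  with b have "0 < \<epsilon>" by (auto simp: ennreal_less_zero_iff)
  from assms[OF this] show "\<forall>\<^sub>F x in G. X x < a"
    by eventually_elim (use b \<open>b = ennreal \<epsilon>\<close> in auto)
qed simp

lemma attracting_compactI:
  assumes "compact K" "K \<noteq> {}" "K \<subseteq> W"
    and att: "\<And>M \<epsilon>. compact M \<Longrightarrow> M \<subseteq> W \<Longrightarrow> 0 < \<epsilon> \<Longrightarrow>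
      \<exists>t0. \<forall>t\<ge>t0. \<forall>y\<in>Y. \<forall>u\<in>M. \<exists>k\<in>K. dist (\<phi> t u y) k \<le> \<epsilon>"
  shows "attracting_compact W Y \<phi> K"
  unfolding attracting_compact_def
proof (intro conjI allI impI assms(1-3) ennreal_tendsto_0I)
  fix M and \<epsilon> :: real assume M: "compact M \<and> M \<subseteq> W" and "0 < \<epsilon>"
  then obtain t0 where "\<And>t y u. t \<ge> t0 \<Longrightarrow> y \<in> Y \<Longrightarrow> u \<in> M \<Longrightarrow> \<exists>k\<in>K. dist (\<phi> t u y) k \<le> \<epsilon>"
    using att by meson
  then have "(SUP y\<in>Y. hausdorff_semidist ((\<lambda>u. \<phi> t u y) ` M) K) \<le> ennreal \<epsilon>" if "t \<ge> t0" for t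
    using that by (intro SUP_least hausdorff_semidist_leI) auto
  then show "\<forall>\<^sub>F t in at_top. (SUP y\<in>Y. hausdorff_semidist ((\<lambda>u. \<phi> t u y) ` M) K) \<le> ennreal \<epsilon>"
    unfolding eventually_at_top_linorder by blast
qed

lemma attracting_compactD:
  assumes "attracting_compact W Y \<phi> K" "compact M" "M \<subseteq> W" "0 < \<epsilon>"
  obtains t0 where "\<And>t y u. t \<ge> t0 \<Longrightarrow> y \<in> Y \<Longrightarrow> u \<in> M \<Longrightarrow> \<exists>k\<in>K. dist (\<phi> t u y) k < \<epsilon>"
proof -
  have "((\<lambda>t. SUP y\<in>Y. hausdorff_semidist ((\<lambda>u. \<phi> t u y) ` M) K) \<longlongrightarrow> 0) at_top"
    using assms unfolding attracting_compact_def by blast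
  then have "\<forall>\<^sub>F t in at_top. (SUP y\<in>Y. hausdorff_semidist ((\<lambda>u. \<phi> t u y) ` M) K) < ennreal \<epsilon>"
    by (rule order_tendstoD) (use assms in simp)
  then obtain t0 where t0: "\<And>t. t \<ge> t0 \<Longrightarrow> (SUP y\<in>Y. hausdorff_semidist ((\<lambda>u. \<phi> t u y) ` M) K) < ennreal \<epsilon>"
    unfolding eventually_at_top_linorder by blast
  show thesis
  proof (rule that[of t0])
    fix t y u assume "t \<ge> t0" "y \<in> Y" "u \<in> M"
    then have "hausdorff_semidist ((\<lambda>u. \<phi> t u y) ` M) K < ennreal \<epsilon>"
      using t0[of t] by (meson SUP_upper le_less_trans)
    then show "\<exists>k\<in>K. dist (\<phi> t u y) k < \<epsilon>"
      using \<open>u \<in> M\<close> by (blast elim: hausdorff_semidist_lessD)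
  qed
qed

text \<open>Nearest points in the compact set have a convergent subsequence, and the given sequence follows
  them.\<close>

lemma subsequence_near_compact:
  fixes c :: "nat \<Rightarrow> 'a::metric_space"
  assumes "compact K" and near: "\<And>\<epsilon>. 0 < \<epsilon> \<Longrightarrow> \<forall>\<^sub>F j in sequentially. \<exists>k\<in>K. dist (c j) k < \<epsilon>"
  obtains l s where "l \<in> K" "strict_mono s" "(\<lambda>j. c (s j)) \<longlonglongrightarrow> l"
proof -
  have "K \<noteq> {}" using near[of 1] by (auto simp: eventually_sequentially)
  have "\<exists>k\<in>K. \<forall>k'\<in>K. dist (c j) k \<le> dist (c j) k'" for j
    by (rule continuous_attains_inf[OF \<open>compact K\<close> \<open>K \<noteq> {}\<close>]) (intro continuous_intros)
  then obtain k where k: "\<And>j. k j \<in> K" "\<And>j k'. k' \<in> K \<Longrightarrow> dist (c j) (k j) \<le> dist (c j) k'"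
    by metis
  have d: "(\<lambda>j. dist (c j) (k j)) \<longlonglongrightarrow> 0"
  proof (rule tendstoI)
    fix e :: real assume "0 < e"
    from near[OF this] show "\<forall>\<^sub>F j in sequentially. dist (dist (c j) (k j)) 0 < e"
      by eventually_elim (use k(2) le_less_trans in \<open>fastforce simp: dist_real_def\<close>)
  qed
  obtain l s where l: "l \<in> K" "strict_mono s" "(k \<circ> s) \<longlonglongrightarrow> l"
    using seq_compactE[OF compact_imp_seq_compact[OF \<open>compact K\<close>], of k] k(1) by auto
  have "(\<lambda>j. c (s j)) \<longlonglongrightarrow> l"
  proof (rule metric_tendsto_imp_tendsto)
    have "(\<lambda>j. dist (c (s j)) (k (s j)) + dist (k (s j)) l) \<longlonglongrightarrow> 0 + 0"
      using LIMSEQ_subseq_LIMSEQ[OF d l(2)] tendsto_dist_iff[THEN iffD1, OF l(3)]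
      by (intro tendsto_add) (auto simp: o_def)
    then show "(\<lambda>j. dist (c (s j)) (k (s j)) + dist (k (s j)) l) \<longlonglongrightarrow> 0" by simp
    show "\<forall>\<^sub>F j in sequentially. dist (c (s j)) l \<le> dist (dist (c (s j)) (k (s j)) + dist (k (s j)) l) 0"
      by (intro always_eventually allI) (simp add: dist_real_def dist_triangle)
  qed
  with l that show thesis by blast
qed

lemma shift_shift: "shift s (shift t f) = shift (s + t) f"
  by (simp add: shift_def add.assoc)

text \<open>What the pullback arguments use of a cocycle: its laws, sequential continuity in the fibre, a
  base that contains the orbit of the one point \<open>y\<close> of interest, and the existence
  of an attracting compact set.\<close>

locale orbit_cocycle =
  fixes W :: "'w::metric_space set" and Y :: "(real \<Rightarrow> 'b) set"
    and \<phi> :: "real \<Rightarrow> 'w \<Rightarrow> (real \<Rightarrow> 'b) \<Rightarrow> 'w" and y :: "real \<Rightarrow> 'b" and K1 :: "'w set"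
  assumes orbit: "\<And>s. shift s y \<in> Y"
    and maps: "\<And>t v g. 0 \<le> t \<Longrightarrow> v \<in> W \<Longrightarrow> g \<in> Y \<Longrightarrow> \<phi> t v g \<in> W"
    and zero: "\<And>v g. v \<in> W \<Longrightarrow> g \<in> Y \<Longrightarrow> \<phi> 0 v g = v"
    and cocycle: "\<And>t s v g. 0 \<le> t \<Longrightarrow> 0 \<le> s \<Longrightarrow> v \<in> W \<Longrightarrow> g \<in> Y \<Longrightarrow> shift s g \<in> Y \<Longrightarrow>
      \<phi> (t + s) v g = \<phi> t (\<phi> s v g) (shift s g)"
    and continuous: "\<And>t g v v'. 0 \<le> t \<Longrightarrow> g \<in> Y \<Longrightarrow> (\<And>j. v j \<in> W) \<Longrightarrow> v' \<in> W \<Longrightarrow> v \<longlonglongrightarrow> v' \<Longrightarrow>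
      (\<lambda>j. \<phi> t (v j) g) \<longlonglongrightarrow> \<phi> t v' g"
    and K1: "attracting_compact W Y \<phi> K1"
begin

text \<open>Images pulled back from ever earlier times approach \<open>K\<close>, and so do the states that
  these trajectories pass at time \<open>\<tau>\<close> before the end. A limit \<open>c\<close>
  of the latter is carried to the limit \<open>x\<close> of the former by continuity.\<close>

lemma pullback_limit:
  assumes K: "attracting_compact W Y \<phi> K" and M: "compact M" "M \<subseteq> W"
    and b: "\<And>j::nat. b j \<in> M" and T: "filterlim T at_top sequentially"
  shows "\<exists>x s. strict_mono s \<and> (\<lambda>j. \<phi> (T (s j)) (b (s j)) (shift (- T (s j)) y)) \<longlonglongrightarrow> x \<and>
    (\<forall>\<tau>\<ge>0. \<exists>c\<in>K. x = \<phi> \<tau> c (shift (- \<tau>) y))"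
proof -
  have comp: "compact K" "K \<subseteq> W" using K by (auto simp: attracting_compact_def)
  let ?c = "\<lambda>\<tau> s j. \<phi> (T (s j) - \<tau>) (b (s j)) (shift (- T (s j)) y)"
  have sub: "\<exists>l s'. l \<in> K \<and> strict_mono s' \<and> (\<lambda>j. ?c \<tau> s (s' j)) \<longlonglongrightarrow> l" if s: "strict_mono s" for s :: "nat \<Rightarrow> nat" and \<tau>
  proof -
    have Ts: "filterlim (\<lambda>j. T (s j)) at_top sequentially"
      by (rule filterlim_compose[OF T filterlim_subseq[OF s]])
    have "\<forall>\<^sub>F j in sequentially. \<exists>k\<in>K. dist (?c \<tau> s j) k < \<epsilon>" if "0 < \<epsilon>" for \<epsilon>
    proof -
      from attracting_compactD[OF K M \<open>0 < \<epsilon>\<close>] obtain t0 where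
        t0: "\<And>t y u. t \<ge> t0 \<Longrightarrow> y \<in> Y \<Longrightarrow> u \<in> M \<Longrightarrow> \<exists>k\<in>K. dist (\<phi> t u y) k < \<epsilon>" by blast
      have "\<forall>\<^sub>F j in sequentially. t0 + \<tau> \<le> T (s j)" using Ts by (auto simp: filterlim_at_top)
      then show ?thesis by eventually_elim (intro t0 orbit b, simp)
    qed
    then obtain l s' where "l \<in> K" "strict_mono s'" "(\<lambda>j. ?c \<tau> s (s' j)) \<longlonglongrightarrow> l"
      by (rule subsequence_near_compact[OF comp(1)])
    then show ?thesis by (intro exI conjI)
  qed
  obtain x s where x: "strict_mono s" "(\<lambda>j. ?c 0 s j) \<longlonglongrightarrow> x"
    using sub[of id 0] strict_mono_id by (auto simp: id_def)
  have "\<exists>c\<in>K. x = \<phi> \<tau> c (shift (- \<tau>) y)" if "0 \<le> \<tau>" for \<tau>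
  proof -
    obtain c s' where c: "c \<in> K" "strict_mono s'" "(\<lambda>j. ?c \<tau> s (s' j)) \<longlonglongrightarrow> c"
      using sub[OF x(1), of \<tau>] by blast
    have "filterlim (\<lambda>j. T (s (s' j))) at_top sequentially"
      using filterlim_compose[OF T filterlim_subseq[OF strict_mono_o[OF x(1) c(2)]]] by (simp add: o_def)
    then obtain J where J: "\<And>j. j \<ge> J \<Longrightarrow> \<tau> \<le> T (s (s' j))"
      by (auto simp: filterlim_at_top eventually_sequentially)
    \<comment> \<open>The first \<open>J\<close> terms are dropped, since their trajectories may be shorter than \<open>\<tau>\<close>.\<close>
    let ?d = "\<lambda>j. ?c \<tau> s (s' (j + J))"
    have "?d j \<in> W" for j
      using J[of "j + J"] b M(2) by (intro maps orbit) auto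
    moreover have "?d \<longlonglongrightarrow> c" using LIMSEQ_ignore_initial_segment[OF c(3), of J] by simp
    ultimately have lim: "(\<lambda>j. \<phi> \<tau> (?d j) (shift (- \<tau>) y)) \<longlonglongrightarrow> \<phi> \<tau> c (shift (- \<tau>) y)"
      using c(1) comp(2) by (intro continuous that orbit) auto
    have eq: "\<phi> \<tau> (?d j) (shift (- \<tau>) y) = ?c 0 s (s' (j + J))" for j
    proof -
      let ?T = "T (s (s' (j + J)))"
      have "\<phi> (\<tau> + (?T - \<tau>)) (b (s (s' (j + J)))) (shift (- ?T) y)
          = \<phi> \<tau> (?d j) (shift (?T - \<tau>) (shift (- ?T) y))"
        using J[of "j + J"] b M(2) that by (intro cocycle orbit) (auto simp: shift_shift orbit)
      then show ?thesis by (simp add: shift_shift)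
    qed
    have "(\<lambda>j. ?c 0 s (s' (j + J))) \<longlonglongrightarrow> x"
      using LIMSEQ_ignore_initial_segment[OF LIMSEQ_subseq_LIMSEQ[OF x(2) c(2)], of J] by (simp add: o_def)
    from LIMSEQ_unique[OF this lim[unfolded eq]] c(1) show ?thesis by blast
  qed
  then show ?thesis using x by (intro exI[of _ x] exI[of _ s]) simp
qed

text \<open>The choice of the attracting compact set in \<^const>\<open>levinson_center\<close> is
  arbitrary, but its points are limits of pullbacks of a compact set, and these can be traced
  back into any attracting compact set \<open>K1\<close>.\<close>

lemma levinson_center_pullback:
  assumes a: "a \<in> levinson_center W Y shift \<phi> y" and "0 \<le> \<tau>"
  shows "\<exists>c\<in>K1. a = \<phi> \<tau> c (shift (- \<tau>) y)"
proof -
  define K where "K = (SOME K. attracting_compact W Y \<phi> K)"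
  have K: "attracting_compact W Y \<phi> K" unfolding K_def by (rule someI[of _ K1]) (rule K1)
  have "\<exists>t k. real j \<le> t \<and> k \<in> K \<and> dist (\<phi> t k (shift (- t) y)) a < inverse (real (Suc j))" for j
  proof -
    have "a \<in> closure (\<Union>\<tau>\<in>{real j..}. (\<lambda>u. \<phi> \<tau> u (shift (- \<tau>) y)) ` K)"
      using a unfolding levinson_center_def K_def[symmetric] Let_def by auto
    then obtain z where "z \<in> (\<Union>\<tau>\<in>{real j..}. (\<lambda>u. \<phi> \<tau> u (shift (- \<tau>) y)) ` K)"
        "dist z a < inverse (real (Suc j))"
      unfolding closure_approachable by (meson inverse_positive_iff_positive of_nat_0_less_iff zero_less_Suc)
    then show ?thesis by auto
  qed
  then obtain T k where T: "\<And>j. real j \<le> T j" and k: "\<And>j. k j \<in> K"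
    and d: "\<And>j. dist (\<phi> (T j) (k j) (shift (- T j) y)) a < inverse (real (Suc j))"
    by metis
  have T_top: "filterlim T at_top sequentially"
    by (rule filterlim_at_top_mono[OF filterlim_real_sequentially]) (simp add: T)
  have KM: "compact K" "K \<subseteq> W" using K by (auto simp: attracting_compact_def)
  obtain x s where s: "strict_mono s"
    and x: "(\<lambda>j. \<phi> (T (s j)) (k (s j)) (shift (- T (s j)) y)) \<longlonglongrightarrow> x"
    and pull: "\<forall>\<tau>\<ge>0. \<exists>c\<in>K1. x = \<phi> \<tau> c (shift (- \<tau>) y)"
    using pullback_limit[where b = k, OF K1 KM k T_top] by blast
  have "(\<lambda>j. \<phi> (T j) (k j) (shift (- T j) y)) \<longlonglongrightarrow> a"
  proof (rule metric_tendsto_imp_tendsto[OF LIMSEQ_inverse_real_of_nat], intro always_eventually allI)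
    show "dist (\<phi> (T j) (k j) (shift (- T j) y)) a \<le> dist (inverse (real (Suc j))) 0" for j
      using less_imp_le[OF d[of j]] by (simp add: dist_real_def)
  qed
  from LIMSEQ_subseq_LIMSEQ[OF this s] x have "x = a"
    by (auto simp: o_def intro: LIMSEQ_unique)
  with pull \<open>0 \<le> \<tau>\<close> show ?thesis by blast
qed

text \<open>Otherwise some pullbacks stay away from the center; a limit of them supplied by
  \<open>pullback_limit\<close> is nevertheless in the center.\<close>

lemma levinson_center_attracts_pullback:
  assumes M: "compact M" "M \<subseteq> W" and "0 < \<epsilon>"
  shows "\<exists>T0. \<forall>T\<ge>T0. \<forall>b\<in>M. \<exists>a\<in>levinson_center W Y shift \<phi> y. dist (\<phi> T b (shift (- T) y)) a < \<epsilon>"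
proof (rule ccontr)
  define K where "K = (SOME K. attracting_compact W Y \<phi> K)"
  have K: "attracting_compact W Y \<phi> K" unfolding K_def by (rule someI[of _ K1]) (rule K1)
  assume no: "\<not> ?thesis"
  have "\<exists>T b. T \<ge> real j \<and> b \<in> M \<and>
      (\<forall>a\<in>levinson_center W Y shift \<phi> y. \<not> dist (\<phi> T b (shift (- T) y)) a < \<epsilon>)" for j :: nat
    using no by blast
  then obtain T b where T: "\<And>j. real j \<le> T j" and b: "\<And>j. b j \<in> M"
    and far: "\<And>j a. a \<in> levinson_center W Y shift \<phi> y \<Longrightarrow> \<not> dist (\<phi> (T j) (b j) (shift (- T j) y)) a < \<epsilon>"
    by metis
  have T_top: "filterlim T at_top sequentially"
    by (rule filterlim_at_top_mono[OF filterlim_real_sequentially]) (simp add: T)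
  obtain x s where s: "strict_mono s"
    and x: "(\<lambda>j. \<phi> (T (s j)) (b (s j)) (shift (- T (s j)) y)) \<longlonglongrightarrow> x"
    and pull: "\<forall>\<tau>\<ge>0. \<exists>c\<in>K. x = \<phi> \<tau> c (shift (- \<tau>) y)"
    using pullback_limit[where b = b, OF K M b T_top] by blast
  have KW: "K \<subseteq> W" using K by (simp add: attracting_compact_def)
  have "x \<in> levinson_center W Y shift \<phi> y"
    unfolding levinson_center_def K_def[symmetric] Let_def
  proof (intro INT_I IntI)
    fix t :: real assume "t \<in> {0..}"
    then obtain c where c: "c \<in> K" "x = \<phi> t c (shift (- t) y)" using pull by auto
    show "x \<in> W" using c KW maps[OF _ _ orbit] \<open>t \<in> {0..}\<close> by auto
    show "x \<in> closure (\<Union>\<tau>\<in>{t..}. (\<lambda>u. \<phi> \<tau> u (shift (- \<tau>) y)) ` K)"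
      by (rule subsetD[OF closure_subset]) (use c in auto)
  qed
  moreover have "\<forall>\<^sub>F j in sequentially. dist (\<phi> (T (s j)) (b (s j)) (shift (- T (s j)) y)) x < \<epsilon>"
    using tendstoD[OF x \<open>0 < \<epsilon>\<close>] .
  then obtain j where "dist (\<phi> (T (s j)) (b (s j)) (shift (- T (s j)) y)) x < \<epsilon>"
    by (auto simp: eventually_sequentially)
  ultimately show False using far by blast
qed

end

section \<open>A compact set that attracts all the systems\<close>

text \<open>The bound \<open>C\<close> and the tail profile \<open>\<gamma>\<close> are all that the
  estimates use of a forcing, so constants depending on them serve the lattice and all
  approximations alike.\<close>

definition forcing_class :: "real \<Rightarrow> (nat \<Rightarrow> real) \<Rightarrow> (real \<Rightarrow> ell2) set" where
  "forcing_class C \<gamma> = {g. continuous_on UNIV g \<and> (\<forall>t. norm (g t) \<le> C \<and> (\<forall>N. tail N (g t) \<le> \<gamma> N))}"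

lemma exp_decay_eventually:
  fixes lam A e :: real
  assumes "0 < lam" "0 < e"
  obtains t0 where "0 \<le> t0" "\<And>t. t0 \<le> t \<Longrightarrow> exp (- lam * t) * A \<le> e"
proof -
  have "((\<lambda>t. exp (- lam * t) * A) \<longlongrightarrow> 0 * A) at_top"
  proof (intro tendsto_mult tendsto_const filterlim_compose[OF exp_at_bot])
    show "filterlim (\<lambda>t. - lam * t) at_bot at_top"
      by (rule filterlim_tendsto_neg_mult_at_bot[OF tendsto_const _ filterlim_ident]) (use assms in simp)
  qed
  then have "\<forall>\<^sub>F t in at_top. exp (- lam * t) * A < e"
    by (rule order_tendstoD) (use assms in simp)
  then obtain t1 where "\<And>t. t1 \<le> t \<Longrightarrow> exp (- lam * t) * A < e"
    unfolding eventually_at_top_linorder by blast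
  then show thesis by (intro that[of "max 0 t1"]) (auto intro: less_imp_le)
qed

context dissipative_lattice begin

text \<open>By \<open>norm_decay\<close>, any number above \<open>C / lam\<close> bounds the norm of a
  solution from some time on, and this time depends only on a bound of the initial norm. The
  square root of \<open>1 + (C / lam)\<^sup>2\<close> is one such number.\<close>

definition radius :: "real \<Rightarrow> real" where
  "radius C = sqrt (1 + (C / lam)\<^sup>2)"

text \<open>The asymptotic bound of \<open>tail_decay\<close> for a solution that starts in the ball of the
  given radius.\<close>

definition tail_level :: "real \<Rightarrow> (nat \<Rightarrow> real) \<Rightarrow> nat \<Rightarrow> real" where
  "tail_level C \<gamma> N =
     (2 * \<nu> * (1 / real (Suc N)) * ((radius C)\<^sup>2 + (C / lam)\<^sup>2) + (\<gamma> N)\<^sup>2 / lam) / lam"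

text \<open>The cut-off at \<open>N div 2\<close> controls the tail at \<open>N\<close>; the summand
  \<open>1 / (N div 2 + 1)\<close> leaves room for the transient of \<open>tail_decay\<close>.\<close>

definition tail_bound :: "real \<Rightarrow> (nat \<Rightarrow> real) \<Rightarrow> nat \<Rightarrow> real" where
  "tail_bound C \<gamma> N = sqrt (1 / real (Suc (N div 2)) + tail_level C \<gamma> (N div 2))"

definition absorbing :: "real \<Rightarrow> (nat \<Rightarrow> real) \<Rightarrow> ell2 set" where
  "absorbing C \<gamma> = {x. norm x \<le> radius C \<and> (\<forall>N. tail N x \<le> tail_bound C \<gamma> N)}"

lemma radius_ge_0: "0 \<le> radius C" by (simp add: radius_def)

lemma tail_level_ge_0: "0 \<le> tail_level C \<gamma> N"
  unfolding tail_level_def using nu_pos lam_pos by simp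

lemma tail_bound_ge_0: "0 \<le> tail_bound C \<gamma> N"
  unfolding tail_bound_def using tail_level_ge_0 by simp

lemma tail_level_tendsto_0: "\<gamma> \<longlonglongrightarrow> 0 \<Longrightarrow> tail_level C \<gamma> \<longlonglongrightarrow> 0"
proof -
  assume "\<gamma> \<longlonglongrightarrow> 0"
  moreover have "(\<lambda>N. 1 / real (Suc N)) \<longlonglongrightarrow> 0"
    using LIMSEQ_inverse_real_of_nat by (simp add: inverse_eq_divide)
  ultimately have "(\<lambda>N. (2 * \<nu> * (1 / real (Suc N)) * ((radius C)\<^sup>2 + (C / lam)\<^sup>2) + (\<gamma> N)\<^sup>2 / lam) / lam)
      \<longlonglongrightarrow> (2 * \<nu> * 0 * ((radius C)\<^sup>2 + (C / lam)\<^sup>2) + 0\<^sup>2 / lam) / lam"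
    using lam_pos by (intro tendsto_intros) auto
  then show ?thesis by (simp add: tail_level_def[abs_def])
qed

lemma tail_bound_tendsto_0: assumes "\<gamma> \<longlonglongrightarrow> 0" shows "tail_bound C \<gamma> \<longlonglongrightarrow> 0"
proof -
  have "(\<lambda>N. 1 / real (Suc N)) \<longlonglongrightarrow> 0"
    using LIMSEQ_inverse_real_of_nat by (simp add: inverse_eq_divide)
  then have "(\<lambda>N. sqrt (1 / real (Suc N) + tail_level C \<gamma> N)) \<longlonglongrightarrow> sqrt (0 + 0)"
    by (intro tendsto_intros tail_level_tendsto_0 assms)
  moreover have "filterlim (\<lambda>N::nat. N div 2) sequentially sequentially"
    unfolding filterlim_at_top eventually_sequentially
  proof
    show "\<exists>N. \<forall>n\<ge>N. Z \<le> n div 2" for Z :: nat by (rule exI[of _ "2 * Z"]) auto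
  qed
  ultimately show ?thesis
    unfolding tail_bound_def by (auto dest: filterlim_compose)
qed

lemma compact_absorbing: "\<gamma> \<longlonglongrightarrow> 0 \<Longrightarrow> compact (absorbing C \<gamma>)"
  unfolding absorbing_def by (rule compact_bounded_uniform_tail[OF tail_bound_tendsto_0])

lemma stability:
  assumes "solves \<nu> lam F p g v u" "solves \<nu> lam F p g v' w" "bij p"
    and g: "\<And>t. norm (g t) \<le> C" and L: "L-lipschitz_on {- (\<rho> + C / lam)..\<rho> + C / lam} F"
    and \<rho>: "norm v \<le> \<rho>" "norm v' \<le> \<rho>" and "0 \<le> t"
  shows "(norm (u t - w t))\<^sup>2 \<le> exp ((2 * (4 * \<nu> + lam + L) + 1) * t) * (norm (v - v'))\<^sup>2"
proof -
  have "norm (u t) \<le> \<rho> + C / lam" if "0 \<le> t" for t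
    using norm_bounded[OF assms(1,3) g that] \<rho> by simp
  moreover have "norm (w t) \<le> \<rho> + C / lam" if "0 \<le> t" for t
    using norm_bounded[OF assms(2,3) g that] \<rho> by simp
  ultimately show ?thesis
    using perturbation_estimate[OF assms(1-3) L, of 0 t] \<open>0 \<le> t\<close> by simp
qed

lemma solution_unique:
  assumes "solves \<nu> lam F p g v u" "solves \<nu> lam F p g v w" "bij p"
    and g: "\<And>t. norm (g t) \<le> C" and "0 \<le> t"
  shows "u t = w t"
proof -
  obtain L where "L-lipschitz_on {- (norm v + C / lam)..norm v + C / lam} F" using loc_lip by blast
  from stability[OF assms(1-4) this order_refl order_refl \<open>0 \<le> t\<close>] show ?thesis by simp
qed

lemma solution_continuous_initial:
  assumes u: "\<And>j. solves \<nu> lam F p g (v j) (u j)" and w: "solves \<nu> lam F p g v' w" and p: "bij p"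
    and g: "\<And>t. norm (g t) \<le> C" and v: "v \<longlonglongrightarrow> v'" and "0 \<le> t"
  shows "(\<lambda>j. u j t) \<longlonglongrightarrow> w t"
proof -
  obtain \<rho> where \<rho>: "\<And>j. norm (v j) \<le> \<rho>"
    using convergent_imp_Bseq[OF convergentI[OF v]] by (auto simp: Bseq_def)
  have \<rho>': "norm v' \<le> \<rho>" by (rule LIMSEQ_le_const2[OF tendsto_norm[OF v]]) (use \<rho> in auto)
  obtain L where L: "L-lipschitz_on {- (\<rho> + C / lam)..\<rho> + C / lam} F" using loc_lip by blast
  let ?E = "exp ((2 * (4 * \<nu> + lam + L) + 1) * t)"
  have "(\<lambda>j. norm (v j - v')) \<longlonglongrightarrow> 0"
    using v by (simp add: tendsto_norm_zero_iff LIM_zero)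
  then have "(\<lambda>j. ?E * (norm (v j - v'))\<^sup>2) \<longlonglongrightarrow> ?E * 0\<^sup>2"
    by (intro tendsto_mult tendsto_const tendsto_power)
  then have "(\<lambda>j. (norm (u j t - w t))\<^sup>2) \<longlonglongrightarrow> 0"
  proof (rule Lim_null_comparison[rotated, OF tendsto_eq_rhs])
    show "\<forall>\<^sub>F j in sequentially. norm ((norm (u j t - w t))\<^sup>2) \<le> ?E * (norm (v j - v'))\<^sup>2"
      by (intro always_eventually allI) (use stability[OF u w p g L \<rho> \<rho>' \<open>0 \<le> t\<close>] in simp)
  qed simp
  from tendsto_real_sqrt[OF this] show ?thesis
    by (simp add: tendsto_norm_zero_iff LIM_zero_iff)
qed

lemma tail_level_decay:
  assumes u: "solves \<nu> lam F p g v u" and p: "near_shift p" and g: "g \<in> forcing_class C \<gamma>"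
    and v: "norm v \<le> radius C" and "0 \<le> t"
  shows "(tail (2 * N) (u t))\<^sup>2 \<le> exp (- lam * t) * (tail N v)\<^sup>2 + tail_level C \<gamma> N"
  unfolding tail_level_def
proof (rule tail_decay[OF u p])
  fix t :: real assume t: "0 \<le> t"
  have "(norm (u t))\<^sup>2 \<le> exp (- lam * t) * (norm v)\<^sup>2 + (C / lam)\<^sup>2"
    by (rule norm_decay[OF u]) (use p g t in \<open>auto simp: near_shift_def forcing_class_def\<close>)
  also have "\<dots> \<le> 1 * (radius C)\<^sup>2 + (C / lam)\<^sup>2"
    using lam_pos t v by (intro add_right_mono mult_mono power_mono) auto
  finally show "(norm (u t))\<^sup>2 \<le> (radius C)\<^sup>2 + (C / lam)\<^sup>2" by simp
qed (use g \<open>0 \<le> t\<close> in \<open>auto simp: forcing_class_def\<close>)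

text \<open>At a given time only finitely many of the tail bounds need to have been reached. Truncating the
  solution at a level \<open>m\<close> where they have been makes the other tails vanish and
  moves the point only by its tail at \<open>m\<close>.\<close>

lemma absorbing_attracts:
  assumes p: "near_shift p" and \<gamma>: "\<gamma> \<longlonglongrightarrow> 0" and "0 < \<epsilon>"
  obtains t0 m where "\<And>t g v u. t0 \<le> t \<Longrightarrow> g \<in> forcing_class C \<gamma> \<Longrightarrow> norm v \<le> R \<Longrightarrow>
    solves \<nu> lam F p g v u \<Longrightarrow> trunc m (u t) \<in> absorbing C \<gamma> \<and> dist (u t) (trunc m (u t)) \<le> \<epsilon>"
proof -
  have bij: "bij p" using p by (simp add: near_shift_def)
  obtain t1 where t1: "0 \<le> t1" "\<And>t. t1 \<le> t \<Longrightarrow> exp (- lam * t) * R\<^sup>2 \<le> 1"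
    using exp_decay_eventually[OF lam_pos, of 1 "R\<^sup>2"] by auto
  obtain m where m: "tail_bound C \<gamma> m < \<epsilon>"
    using order_tendstoD(2)[OF tail_bound_tendsto_0[OF \<gamma>] \<open>0 < \<epsilon>\<close>] by (auto simp: eventually_sequentially)
  obtain t2 where t2: "0 \<le> t2" "\<And>t. t2 \<le> t \<Longrightarrow> exp (- lam * t) * (radius C)\<^sup>2 \<le> 1 / real (Suc m)"
    using exp_decay_eventually[OF lam_pos, of "1 / real (Suc m)" "(radius C)\<^sup>2"] by auto
  show thesis
  proof (rule that[of "t1 + t2" m])
    fix t g v u
    assume t: "t1 + t2 \<le> t" and g: "g \<in> forcing_class C \<gamma>" and v: "norm v \<le> R" and u: "solves \<nu> lam F p g v u"
    have norm_u: "norm (u s) \<le> radius C" if "t1 \<le> s" for s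
    proof -
      have "(norm (u s))\<^sup>2 \<le> exp (- lam * s) * (norm v)\<^sup>2 + (C / lam)\<^sup>2"
        by (rule norm_decay[OF u bij]) (use g t1(1) that in \<open>auto simp: forcing_class_def\<close>)
      also have "exp (- lam * s) * (norm v)\<^sup>2 \<le> exp (- lam * s) * R\<^sup>2"
        using v by (intro mult_left_mono power_mono) auto
      finally show ?thesis
        unfolding radius_def using t1(2)[OF that] by (intro real_le_rsqrt) simp
    qed
    have sg: "shift t1 g \<in> forcing_class C \<gamma>"
      using g unfolding forcing_class_def shift_def
      by (auto intro!: continuous_on_compose2[of UNIV g] continuous_intros)
    have tail_u: "tail N (u t) \<le> tail_bound C \<gamma> N" if "N \<le> m" for N
      unfolding tail_bound_def
    proof (rule real_le_rsqrt)
      let ?N = "N div 2"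
      have "(tail N (u t))\<^sup>2 \<le> (tail (2 * ?N) (u (t - t1 + t1)))\<^sup>2"
        by (intro power_mono) (auto intro: tail_antimono)
      also have "\<dots> \<le> exp (- lam * (t - t1)) * (tail ?N (u t1))\<^sup>2 + tail_level C \<gamma> ?N"
        by (rule tail_level_decay[OF solves_shift[OF u t1(1)] p sg norm_u[OF order_refl]]) (use t t2 in auto)
      also have "exp (- lam * (t - t1)) * (tail ?N (u t1))\<^sup>2 \<le> exp (- lam * (t - t1)) * (radius C)\<^sup>2"
        using order_trans[OF tail_le_norm norm_u[OF order_refl]] by (intro mult_left_mono power_mono) auto
      also have "\<dots> \<le> 1 / real (Suc m)" using t by (intro t2(2)) simp
      also have "\<dots> \<le> 1 / real (Suc ?N)" using that by (intro divide_left_mono) auto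
      finally show "(tail N (u t))\<^sup>2 \<le> 1 / real (Suc ?N) + tail_level C \<gamma> ?N" by simp
    qed
    have "tail N (trunc m (u t)) \<le> tail_bound C \<gamma> N" for N
      using tail_u[of N] tail_trunc_le[of N m "u t"] tail_trunc_eq_0[of m N "u t"] tail_bound_ge_0[of C \<gamma> N]
      by (cases "N \<le> m") auto
    moreover have "norm (trunc m (u t)) \<le> radius C"
      using norm_trunc_le[of m "u t"] norm_u[of t] t t2(1) by simp
    ultimately show "trunc m (u t) \<in> absorbing C \<gamma> \<and> dist (u t) (trunc m (u t)) \<le> \<epsilon>"
      using tail_u[of m] m by (simp add: absorbing_def dist_norm tail_def)
  qed
qed

end

text \<open>A cocycle made of solutions on a closed invariant subspace \<open>W\<close>, which is
  \<open>\<ell>\<^sub>2\<close> or a coordinate subspace.\<close>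

locale solution_cocycle = dissipative_lattice +
  fixes p :: "int \<Rightarrow> int" and W :: "ell2 set" and Y :: "(real \<Rightarrow> ell2) set"
    and \<phi> :: "real \<Rightarrow> ell2 \<Rightarrow> (real \<Rightarrow> ell2) \<Rightarrow> ell2" and C :: real and \<gamma> :: "nat \<Rightarrow> real"
  assumes near: "near_shift p" and closed_W: "closed W" and zero_W: "0 \<in> W"
    and trunc_W: "\<And>m x. x \<in> W \<Longrightarrow> trunc m x \<in> W"
    and Y: "Y \<subseteq> forcing_class C \<gamma>" and \<gamma>: "\<gamma> \<longlonglongrightarrow> 0"
    and sol: "\<And>v g. v \<in> W \<Longrightarrow> g \<in> Y \<Longrightarrow> solves \<nu> lam F p g v (\<lambda>t. \<phi> t v g)"
    and maps_W: "\<And>t v g. 0 \<le> t \<Longrightarrow> v \<in> W \<Longrightarrow> g \<in> Y \<Longrightarrow> \<phi> t v g \<in> W"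
begin

lemma bij: "bij p" using near by (simp add: near_shift_def)

lemma norm_forcing: "g \<in> Y \<Longrightarrow> norm (g t) \<le> C"
  using Y by (auto simp: forcing_class_def)

lemma attracting_absorbing: "attracting_compact W Y \<phi> (absorbing C \<gamma> \<inter> W)"
proof (rule attracting_compactI)
  show "compact (absorbing C \<gamma> \<inter> W)" by (intro compact_Int_closed compact_absorbing \<gamma> closed_W)
  have "0 \<in> absorbing C \<gamma>"
    using tail_le_norm[of _ 0] tail_bound_ge_0 order_trans by (fastforce simp: absorbing_def radius_ge_0)
  then show "absorbing C \<gamma> \<inter> W \<noteq> {}" using zero_W by blast
  fix M and \<epsilon> :: real assume M: "compact M" "M \<subseteq> W" and "0 < \<epsilon>"
  obtain R where R: "\<And>v. v \<in> M \<Longrightarrow> norm v \<le> R" using compact_imp_bounded[OF M(1)] by (auto simp: bounded_iff)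
  obtain t0 m where t0: "\<And>t g v u. t0 \<le> t \<Longrightarrow> g \<in> forcing_class C \<gamma> \<Longrightarrow> norm v \<le> R \<Longrightarrow>
    solves \<nu> lam F p g v u \<Longrightarrow> trunc m (u t) \<in> absorbing C \<gamma> \<and> dist (u t) (trunc m (u t)) \<le> \<epsilon>"
    using absorbing_attracts[OF near \<gamma> \<open>0 < \<epsilon>\<close>] by blast
  have "\<exists>k\<in>absorbing C \<gamma> \<inter> W. dist (\<phi> t u y) k \<le> \<epsilon>" if "max 0 t0 \<le> t" "y \<in> Y" "u \<in> M" for t y u
  proof -
    have "trunc m (\<phi> t u y) \<in> absorbing C \<gamma> \<and> dist (\<phi> t u y) (trunc m (\<phi> t u y)) \<le> \<epsilon>"
      using that M(2) Y R by (intro t0[where g = y and v = u and u = "\<lambda>t. \<phi> t u y"] sol) auto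
    moreover have "trunc m (\<phi> t u y) \<in> W" using that M(2) by (intro trunc_W maps_W) auto
    ultimately show ?thesis by blast
  qed
  then show "\<exists>t0. \<forall>t\<ge>t0. \<forall>y\<in>Y. \<forall>u\<in>M. \<exists>k\<in>absorbing C \<gamma> \<inter> W. dist (\<phi> t u y) k \<le> \<epsilon>" by blast
qed simp

lemma orbit_cocycle:
  assumes "\<And>s. shift s y \<in> Y"
  shows "orbit_cocycle W Y \<phi> y (absorbing C \<gamma> \<inter> W)"
proof
  show "\<phi> 0 v g = v" if "v \<in> W" "g \<in> Y" for v g
    using sol[OF that] by (simp add: solves_def)
  show "\<phi> (t + s) v g = \<phi> t (\<phi> s v g) (shift s g)"
    if "0 \<le> t" "0 \<le> s" "v \<in> W" "g \<in> Y" "shift s g \<in> Y" for t s v g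
  proof -
    have 1: "solves \<nu> lam F p (shift s g) (\<phi> s v g) (\<lambda>t. \<phi> (t + s) v g)"
      by (rule solves_shift[OF sol[OF that(3,4)] that(2)])
    have 2: "solves \<nu> lam F p (shift s g) (\<phi> s v g) (\<lambda>t. \<phi> t (\<phi> s v g) (shift s g))"
      by (rule sol[OF maps_W[OF that(2-4)] that(5)])
    show ?thesis by (rule solution_unique[OF 1 2 bij norm_forcing[OF that(5)] that(1)])
  qed
  show "(\<lambda>j. \<phi> t (v j) g) \<longlonglongrightarrow> \<phi> t v' g"
    if "0 \<le> t" "g \<in> Y" "\<And>j. v j \<in> W" "v' \<in> W" "v \<longlonglongrightarrow> v'" for t g v v'
    using that
    by (intro solution_continuous_initial[OF sol sol bij norm_forcing]) auto
qed (use assms maps_W attracting_absorbing in auto)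

end

section \<open>Hulls of Lagrange stable forcings\<close>

lemma openin_compact_open_topology:
  assumes "compact K" "open U"
  shows "openin compact_open_topology {f. continuous_on UNIV f \<and> f ` K \<subseteq> U}"
  unfolding compact_open_topology_def
proof (rule topology_generated_by_Basis, rule CollectI)
  show "\<exists>K' U'. {f. continuous_on UNIV f \<and> f ` K \<subseteq> U} = {f. continuous_on UNIV f \<and> f ` K' \<subseteq> U'}
      \<and> compact K' \<and> open U'"
    using assms by (intro exI[of _ K] exI[of _ U]) simp
qed

text \<open>Membership of a value in the open complement of \<open>S\<close> is an open condition in the
  compact-open topology, so no limit of shifts can satisfy it.\<close>

lemma shift_hull_values:
  assumes g: "g \<in> shift_hull f" and S: "closed S" "\<And>t. f t \<in> S"
  shows "continuous_on UNIV g" "g t \<in> S"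
proof -
  note cl = g[unfolded shift_hull_def in_closure_of]
  have top: "g \<in> topspace compact_open_topology" by (rule conjunct1[OF cl])
  note meets = conjunct2[OF cl, rule_format]
  from top show cont: "continuous_on UNIV g" by (simp add: topspace_compact_open_topology)
  show "g t \<in> S"
  proof (rule ccontr)
    assume "g t \<notin> S"
    let ?U = "{h. continuous_on UNIV h \<and> h ` {t} \<subseteq> - S}"
    have "openin compact_open_topology ?U"
      by (rule openin_compact_open_topology) (use S(1) in auto)
    moreover have "g \<in> ?U" using cont \<open>g t \<notin> S\<close> by simp
    ultimately have "\<exists>h. h \<in> range (\<lambda>h. shift h f) \<and> h \<in> ?U" by (intro meets conjI)
    then obtain h where "shift h f \<in> ?U" by auto
    then show False using S(2) by (simp add: shift_def)
  qed
qed

lemma shift_in_hull: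
  assumes "continuous_on UNIV f" shows "shift h f \<in> shift_hull f"
proof -
  have "continuous_on UNIV (shift h f)" for h
    unfolding shift_def by (rule continuous_on_compose2[OF assms]) (auto intro: continuous_intros)
  then have "range (\<lambda>h. shift h f) \<subseteq> topspace compact_open_topology"
    by (simp add: topspace_compact_open_topology image_subset_iff)
  from subsetD[OF closure_of_subset[OF this] rangeI[of _ h]]
  show ?thesis by (simp add: shift_hull_def)
qed

text \<open>Evaluation at \<open>0\<close> is continuous on \<open>C(\<real>, B)\<close>, and the image of
  the compact hull contains every value of \<open>f\<close>.\<close>

lemma lagrange_stable_compact_range:
  fixes f :: "real \<Rightarrow> 'b::t2_space"
  assumes cont: "continuous_on UNIV f" and "lagrange_stable f"
  shows "compact (closure (range f))"
proof -
  have "continuous_map compact_open_topology euclidean (\<lambda>g::real \<Rightarrow> 'b. g 0)"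
    unfolding continuous_map_def
  proof (intro conjI allI impI)
    fix U :: "'b set" assume "openin euclidean U"
    then have "open U" by simp
    have "{g \<in> topspace compact_open_topology. g 0 \<in> U} = {g::real \<Rightarrow> 'b. continuous_on UNIV g \<and> g ` {0} \<subseteq> U}"
      by (auto simp: topspace_compact_open_topology)
    also have "openin compact_open_topology \<dots>"
      by (rule openin_compact_open_topology) (use \<open>open U\<close> in auto)
    finally show "openin compact_open_topology {g \<in> topspace compact_open_topology. g (0::real) \<in> U}" .
  qed simp
  from image_compactin[OF assms(2)[unfolded lagrange_stable_def] this]
  have K: "compact ((\<lambda>g. g 0) ` shift_hull f)" by simp
  have "f t \<in> (\<lambda>g. g 0) ` shift_hull f" for t
    using shift_in_hull[OF cont, of t] by (rule rev_image_eqI) (simp add: shift_def)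
  then have "closure (range f) \<subseteq> (\<lambda>g. g 0) ` shift_hull f"
    by (intro closure_minimal compact_imp_closed K) auto
  then show ?thesis
    using compact_Int_closed[OF K closed_closure, of "range f"] by (simp add: inf.absorb2)
qed

section \<open>The lattice and its periodic approximations\<close>

definition succ :: "int \<Rightarrow> int" where "succ i = i + 1"

text \<open>The sites outside \<open>{- n..n}\<close> are left in place, so the coupling vanishes there.\<close>

definition cycle :: "nat \<Rightarrow> int \<Rightarrow> int" where
  "cycle n i = (if \<bar>i\<bar> \<le> int n then right_nb n i else i)"

lemma bij_inv_of_inverses:
  assumes "\<And>i. q (p i) = i" "\<And>i. p (q i) = i"
  shows "bij p" "inv p = q"
proof -
  show "bij p" by (rule o_bij[of q]) (simp_all add: fun_eq_iff assms)
  show "inv p = q" by (rule inv_equality) (simp_all add: assms)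
qed

lemma succ_inverse: "bij succ" "inv succ = (\<lambda>i. i - 1)"
  using bij_inv_of_inverses[of "\<lambda>i. i - 1" succ] by (simp_all add: succ_def)

lemma cycle_inverse:
  "bij (cycle n)" "inv (cycle n) = (\<lambda>i. if \<bar>i\<bar> \<le> int n then left_nb n i else i)"
proof -
  let ?q = "\<lambda>i. if \<bar>i\<bar> \<le> int n then left_nb n i else i"
  have 1: "?q (cycle n i) = i" and 2: "cycle n (?q i) = i" for i
    by (auto simp: cycle_def left_nb_def right_nb_def)
  show "bij (cycle n)" "inv (cycle n) = ?q"
    using bij_inv_of_inverses[of ?q "cycle n", OF 1 2] by blast+
qed

lemma near_shift_succ: "near_shift succ"
  unfolding near_shift_def using succ_inverse(1) by (auto simp: succ_def)

lemma near_shift_cycle: "near_shift (cycle n)"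
  unfolding near_shift_def using cycle_inverse(1) by (auto simp: cycle_def right_nb_def)

lemma bounded_linear_trunc: "bounded_linear (trunc n)"
  by (rule bounded_linear_intro[where K = 1])
    (auto intro!: ell2_eqI simp: trunc.rep_eq norm_trunc_le)

lemma bounded_linear_coord: "bounded_linear (\<lambda>x. coord x i)"
  by (rule bounded_linear_intro[where K = 1]) (auto simp: abs_coord_le_norm)

lemma trunc_in_coord_space: "trunc n x \<in> coord_space n"
  using range_trunc by blast

lemma trunc_id: "x \<in> coord_space n \<Longrightarrow> trunc n x = x"
  by (rule ell2_eqI) (auto simp: coord_space_def trunc.rep_eq)

context dissipative_lattice begin

lemma lattice_solution_iff:
  "lattice_solution \<nu> lam F g v u \<longleftrightarrow> solves \<nu> lam F succ g v u"
proof -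
  have "(\<forall>i. coord w i = \<nu> * (coord x (i - 1) - 2 * coord x i + coord x (i + 1))
           - lam * coord x i + F (coord x i) + coord h i) \<longleftrightarrow> w = field \<nu> lam F succ x + h" for w x h
    by (auto simp: coord_field succ_inverse succ_def intro!: ell2_eqI)
  then show ?thesis unfolding lattice_solution_def solves_def by simp
qed

lemma lattice_cocycle_solves:
  assumes "g \<in> forcing_class C \<gamma>"
  shows "solves \<nu> lam F succ g v (\<lambda>t. lattice_cocycle \<nu> lam F t v g)"
proof -
  obtain u where "solves \<nu> lam F succ g v u"
    using solution_exists[OF succ_inverse(1), of g C v] assms by (auto simp: forcing_class_def)
  then have "solves \<nu> lam F succ g v (SOME u. lattice_solution \<nu> lam F g v u)"
    unfolding lattice_solution_iff by (rule someI[of "solves \<nu> lam F succ g v"])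
  then show ?thesis unfolding lattice_cocycle_def .
qed

text \<open>Outside \<open>{- n..n}\<close> both sides of the equation vanish: the solution and the forcing
  are \<open>0\<close> there, \<open>cycle n\<close> fixes the site, and \<open>F 0 = 0\<close>.\<close>

lemma approx_solution_solves:
  assumes u: "approx_solution \<nu> lam F n g v u" and g: "\<And>t. g t \<in> coord_space n"
  shows "solves \<nu> lam F (cycle n) g v u"
  unfolding solves_def
proof (intro conjI allI impI)
  show "u 0 = v" using u by (simp add: approx_solution_def)
  fix t :: real assume "0 \<le> t"
  then obtain w where w: "(u has_vector_derivative w) (at t within {0..})"
    and in_range: "\<And>i. \<bar>i\<bar> \<le> int n \<Longrightarrow> coord w i =
           \<nu> * (coord (u t) (left_nb n i) - 2 * coord (u t) i + coord (u t) (right_nb n i))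
           - lam * coord (u t) i + F (coord (u t) i) + coord (g t) i"
    using u unfolding approx_solution_def by blast
  have "coord w i = 0" if i: "\<bar>i\<bar> > int n" for i
  proof (rule vector_derivative_unique_within)
    have zero: "coord (u s) i = 0" if "0 \<le> s" for s
      using u that i by (auto simp: approx_solution_def coord_space_def)
    show "((\<lambda>t. coord (u t) i) has_vector_derivative coord w i) (at t within {0..})"
      by (rule bounded_linear.has_vector_derivative[OF bounded_linear_coord w])
    show "((\<lambda>t. coord (u t) i) has_vector_derivative 0) (at t within {0..})"
      by (rule has_vector_derivative_transform[OF _ _ has_vector_derivative_const[of 0]])
        (use zero \<open>0 \<le> t\<close> in auto)
    show "at t within {0..} \<noteq> bot"
    proof -
      have "at_right t \<le> at t within {0..}" using \<open>0 \<le> t\<close> by (intro at_le) auto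
      then show ?thesis using trivial_limit_at_right_real[of t] by (auto simp: bot_unique)
    qed
  qed
  moreover have "u t \<in> coord_space n" using u \<open>0 \<le> t\<close> by (simp add: approx_solution_def)
  ultimately have "w = field \<nu> lam F (cycle n) (u t) + g t"
    using in_range g[of t]
    by (intro ell2_eqI)
      (auto simp: coord_field cycle_inverse cycle_def coord_space_def F_0)
  with w show "(u has_vector_derivative field \<nu> lam F (cycle n) (u t) + g t) (at t within {0..})" by simp
qed

text \<open>The coordinates in \<open>{- n..n}\<close> form a closed subsystem, so the truncation of a
  solution of the extended equation solves the approximation.\<close>

lemma approx_solution_exists:
  assumes g: "g \<in> forcing_class C \<gamma>" "\<And>t. g t \<in> coord_space n" and v: "v \<in> coord_space n"
  obtains u where "approx_solution \<nu> lam F n g v u"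
proof -
  obtain u where u: "solves \<nu> lam F (cycle n) g v u"
    using solution_exists[OF cycle_inverse(1), where g = g and C = C and v = v] g by (auto simp: forcing_class_def)
  have "approx_solution \<nu> lam F n g v (\<lambda>t. trunc n (u t))"
    unfolding approx_solution_def
  proof (intro conjI allI impI exI)
    show "trunc n (u 0) = v" using u v by (simp add: solves_def trunc_id)
    show "trunc n (u t) \<in> coord_space n" for t by (rule trunc_in_coord_space)
    show "((\<lambda>t. trunc n (u t)) has_vector_derivative trunc n (field \<nu> lam F (cycle n) (u t) + g t)) (at t within {0..})"
      if "0 \<le> t" for t
      by (rule bounded_linear.has_vector_derivative[OF bounded_linear_trunc])
        (use u that in \<open>simp add: solves_def\<close>)
    show "coord (trunc n (field \<nu> lam F (cycle n) (u t) + g t)) i =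
        \<nu> * (coord (trunc n (u t)) (left_nb n i) - 2 * coord (trunc n (u t)) i + coord (trunc n (u t)) (right_nb n i))
           - lam * coord (trunc n (u t)) i + F (coord (trunc n (u t)) i) + coord (g t) i"
      if "\<bar>i\<bar> \<le> int n" for t i
    proof -
      have "\<bar>left_nb n i\<bar> \<le> int n" "\<bar>right_nb n i\<bar> \<le> int n"
        using that by (auto simp: left_nb_def right_nb_def)
      then show ?thesis using that by (simp add: trunc.rep_eq coord_field cycle_inverse cycle_def)
    qed
  qed
  then show thesis by (rule that)
qed

lemma approx_cocycle_solves:
  assumes g: "g \<in> forcing_class C \<gamma>" "\<And>t. g t \<in> coord_space n" and v: "v \<in> coord_space n"
  shows "solves \<nu> lam F (cycle n) g v (\<lambda>t. approx_cocycle \<nu> lam F n t v g)"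
    and "0 \<le> t \<Longrightarrow> approx_cocycle \<nu> lam F n t v g \<in> coord_space n"
proof -
  obtain u where "approx_solution \<nu> lam F n g v u" using approx_solution_exists[OF assms] .
  then have "approx_solution \<nu> lam F n g v (SOME u. approx_solution \<nu> lam F n g v u)"
    by (rule someI[of "approx_solution \<nu> lam F n g v"])
  then have *: "approx_solution \<nu> lam F n g v (\<lambda>t. approx_cocycle \<nu> lam F n t v g)"
    unfolding approx_cocycle_def .
  show "solves \<nu> lam F (cycle n) g v (\<lambda>t. approx_cocycle \<nu> lam F n t v g)"
    by (rule approx_solution_solves[OF * g(2)])
  show "0 \<le> t \<Longrightarrow> approx_cocycle \<nu> lam F n t v g \<in> coord_space n"
    using * by (simp add: approx_solution_def)
qed

text \<open>Along the approximating solution the residual in the lattice equation consists of its tail,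
  where the two couplings may differ, and of the tail of the forcing. Both are small uniformly
  over initial values in \<open>absorbing\<close> and over the forcings, because the tail
  estimate does not depend on \<open>n\<close>.\<close>

lemma periodic_approximation_converges:
  assumes \<gamma>: "\<gamma> \<longlonglongrightarrow> 0" and "0 < \<epsilon>" "0 \<le> T"
  shows "\<exists>n0. \<forall>n\<ge>n0. \<forall>b\<in>absorbing C \<gamma>. \<forall>g\<in>forcing_class C \<gamma>. \<forall>u w.
    solves \<nu> lam F succ g b u \<longrightarrow> solves \<nu> lam F (cycle n) (trunc n \<circ> g) b w \<longrightarrow> dist (w T) (u T) < \<epsilon>"
proof -
  define r where "r = radius C + C / lam"
  obtain L where L: "L-lipschitz_on {-r..r} F" using loc_lip by blast
  define E where "E = exp ((2 * (4 * \<nu> + lam + L) + 1) * T)"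
  \<comment> \<open>A residual \<open>\<eta>\<close> grows up to time \<open>T\<close> at most to \<open>sqrt E * \<eta>\<close>, which is below \<open>\<epsilon>\<close> because \<open>E \<ge> 1\<close>.\<close>
  define \<eta> where "\<eta> = \<epsilon> / (2 * E)"
  have "0 < E" "0 < \<eta>" using \<open>0 < \<epsilon>\<close> by (simp_all add: E_def \<eta>_def)
  have "0 \<le> (2 * (4 * \<nu> + lam + L) + 1) * T"
    using nu_pos lam_pos lipschitz_on_nonneg[OF L] \<open>0 \<le> T\<close> by (intro mult_nonneg_nonneg) auto
  then have "1 \<le> E" by (simp add: E_def)
  have small: "E * \<eta>\<^sup>2 < \<epsilon>\<^sup>2"
  proof -
    have "E * \<eta>\<^sup>2 = \<epsilon>\<^sup>2 / (4 * E)" using \<open>0 < E\<close> by (simp add: \<eta>_def power2_eq_square field_simps)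
    also have "\<dots> < \<epsilon>\<^sup>2" using \<open>1 \<le> E\<close> \<open>0 < \<epsilon>\<close> by (simp add: divide_less_eq)
    finally show ?thesis .
  qed
  have "(\<lambda>N. 4 * \<nu> * sqrt ((tail_bound C \<gamma> N)\<^sup>2 + tail_level C \<gamma> N)) \<longlonglongrightarrow> 4 * \<nu> * sqrt (0\<^sup>2 + 0)"
    by (intro tendsto_intros tail_bound_tendsto_0 tail_level_tendsto_0 \<gamma>)
  then have "\<forall>\<^sub>F N in sequentially. 4 * \<nu> * sqrt ((tail_bound C \<gamma> N)\<^sup>2 + tail_level C \<gamma> N) < \<eta> / 2"
    by (rule order_tendstoD) (use \<open>0 < \<eta>\<close> in simp)
  then obtain N where N: "4 * \<nu> * sqrt ((tail_bound C \<gamma> N)\<^sup>2 + tail_level C \<gamma> N) < \<eta> / 2"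
    by (auto simp: eventually_sequentially)
  obtain n1 where n1: "\<And>n. n \<ge> n1 \<Longrightarrow> \<gamma> n < \<eta> / 2"
    using order_tendstoD(2)[OF \<gamma>, of "\<eta> / 2"] \<open>0 < \<eta>\<close> by (auto simp: eventually_sequentially)
  show ?thesis
  proof (intro exI[of _ "max n1 (2 * N + 1)"] allI ballI impI)
    fix n b g u w
    assume n: "max n1 (2 * N + 1) \<le> n" and b: "b \<in> absorbing C \<gamma>" and g: "g \<in> forcing_class C \<gamma>"
      and u: "solves \<nu> lam F succ g b u" and w: "solves \<nu> lam F (cycle n) (trunc n \<circ> g) b w"
    have normb: "norm b \<le> radius C" using b by (simp add: absorbing_def)
    have tg: "trunc n \<circ> g \<in> forcing_class C \<gamma>"
      using g unfolding forcing_class_def o_def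
      by (auto intro: continuous_intros order_trans[OF norm_trunc_le] order_trans[OF tail_trunc_le])
    have ur: "norm (u t) \<le> r" if "0 \<le> t" for t
    proof -
      have "norm (u t) \<le> norm b + C / lam"
        by (rule norm_bounded[OF u succ_inverse(1) _ that]) (use g in \<open>simp add: forcing_class_def\<close>)
      then show ?thesis using normb by (simp add: r_def)
    qed
    have wr: "norm (w t) \<le> r" if "0 \<le> t" for t
    proof -
      have "norm (w t) \<le> norm b + C / lam"
        by (rule norm_bounded[OF w cycle_inverse(1) _ that]) (use tg in \<open>simp add: forcing_class_def\<close>)
      then show ?thesis using normb by (simp add: r_def)
    qed
    have res: "norm ((field \<nu> lam F succ (w t) + g t) - (field \<nu> lam F (cycle n) (w t) + (trunc n \<circ> g) t)) \<le> \<eta>"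
      if t: "0 \<le> t" for t
    proof -
      have "(tail (2 * N) (w t))\<^sup>2 \<le> exp (- lam * t) * (tail N b)\<^sup>2 + tail_level C \<gamma> N"
        by (rule tail_level_decay[OF w near_shift_cycle tg normb t])
      also have "\<dots> \<le> 1 * (tail_bound C \<gamma> N)\<^sup>2 + tail_level C \<gamma> N"
        using lam_pos t b by (intro add_right_mono mult_mono power_mono) (auto simp: absorbing_def)
      finally have "tail (2 * N) (w t) \<le> sqrt ((tail_bound C \<gamma> N)\<^sup>2 + tail_level C \<gamma> N)"
        by (intro real_le_rsqrt) simp
      then have tail_w: "4 * \<nu> * tail (2 * N) (w t) \<le> \<eta> / 2"
        using N nu_pos
          mult_left_mono[of "tail (2 * N) (w t)" "sqrt ((tail_bound C \<gamma> N)\<^sup>2 + tail_level C \<gamma> N)" "4 * \<nu>"]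
        by linarith
      have "norm (field \<nu> lam F succ (w t) - field \<nu> lam F (cycle n) (w t)) \<le> 4 * \<nu> * tail (2 * N) (w t)"
      proof (rule field_agree[OF succ_inverse(1) cycle_inverse(1)])
        show "succ i = cycle n i \<and> inv succ i = inv (cycle n) i" if "\<bar>i\<bar> \<le> int (2 * N)" for i
          using that n by (auto simp: succ_inverse cycle_inverse succ_def cycle_def left_nb_def right_nb_def)
      qed (use nu_pos in simp)
      moreover have "norm (g t - trunc n (g t)) \<le> \<eta> / 2"
      proof -
        have "norm (g t - trunc n (g t)) \<le> \<gamma> n"
          using g by (simp add: forcing_class_def tail_def)
        then show ?thesis using n1[of n] n by simp
      qed
      moreover have "(field \<nu> lam F succ (w t) + g t) - (field \<nu> lam F (cycle n) (w t) + (trunc n \<circ> g) t)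
          = (field \<nu> lam F succ (w t) - field \<nu> lam F (cycle n) (w t)) + (g t - trunc n (g t))"
        by simp
      ultimately show ?thesis using tail_w by (simp only:) (rule norm_triangle_le, linarith)
    qed
    have "(norm (u T - w T))\<^sup>2 \<le> E * ((norm (b - b))\<^sup>2 + \<eta>\<^sup>2)"
      unfolding E_def by (rule perturbation_estimate[OF u w succ_inverse(1) L ur wr res \<open>0 \<le> T\<close>])
    with small have "(norm (u T - w T))\<^sup>2 < \<epsilon>\<^sup>2" by simp
    then show "dist (w T) (u T) < \<epsilon>"
      using \<open>0 < \<epsilon>\<close> by (auto simp: dist_norm norm_minus_commute intro: power2_less_imp_less)
  qed
qed

end

section \<open>Convergence of the attractors\<close>

theorem theorem7p2:
  fixes \<nu> lam :: real and F :: "real \<Rightarrow> real" and f :: "real \<Rightarrow> ell2"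
  assumes "\<nu> > 0" and "lam > 0"
    and "continuous_on UNIV F"
    and "\<And>B. bounded B \<Longrightarrow> \<exists>L. L-lipschitz_on B F"
    and "F 0 = 0"
    and "\<And>s. F s * s \<le> 0"
    and "continuous_on UNIV f"
    and "lagrange_stable f"
  shows "(\<lambda>n. hausdorff_semidist
               (approx_attractor \<nu> lam F n (trunc n \<circ> f) (trunc n \<circ> f))
               (lattice_attractor \<nu> lam F f f)) \<longlonglongrightarrow> 0"
proof -
  interpret dissipative_lattice \<nu> lam F
    by unfold_locales (use assms in auto)
  have Q: "compact (closure (range f))" by (rule lagrange_stable_compact_range[OF assms(7,8)])
  obtain C where C: "\<And>x. x \<in> closure (range f) \<Longrightarrow> norm x \<le> C"
    using compact_imp_bounded[OF Q] by (auto simp: bounded_iff)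
  obtain \<gamma> where \<gamma>: "\<gamma> \<longlonglongrightarrow> 0" "\<And>N x. x \<in> closure (range f) \<Longrightarrow> tail N x \<le> \<gamma> N"
    using compact_uniform_tail[OF Q] by blast
  \<comment> \<open>A closed set of values that contains the ranges of \<open>f\<close> and of all its truncations, hence those of all functions in their hulls.\<close>
  let ?S = "{x. norm x \<le> C \<and> (\<forall>N. tail N x \<le> \<gamma> N)}"
  have S: "closed ?S"
    by (intro closed_Collect_conj closed_Collect_all closed_Collect_le continuous_on_tail continuous_intros)
  have fS: "f t \<in> ?S" for t
    using C \<gamma>(2) subsetD[OF closure_subset rangeI[of f t]] by blast
  have fnS: "(trunc n \<circ> f) t \<in> ?S" for n t
    using fS[of t] by (auto intro: order_trans[OF norm_trunc_le] order_trans[OF tail_trunc_le])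
  have cont_fn: "continuous_on UNIV (trunc n \<circ> f)" for n
    using continuous_on_trunc[OF assms(7)] by (simp add: o_def)
  have hull: "shift_hull f \<subseteq> forcing_class C \<gamma>"
    unfolding forcing_class_def using shift_hull_values[where f = f, OF _ S fS] by blast
  have hull_n: "shift_hull (trunc n \<circ> f) \<subseteq> forcing_class C \<gamma>" for n
    unfolding forcing_class_def using shift_hull_values[where f = "trunc n \<circ> f", OF _ S fnS] by blast
  have hull_n': "g t \<in> coord_space n" if "g \<in> shift_hull (trunc n \<circ> f)" for g t n
    by (rule shift_hull_values(2)[OF that closed_coord_space]) (simp add: trunc_in_coord_space)

  interpret lat: solution_cocycle \<nu> lam F succ UNIV "shift_hull f" "lattice_cocycle \<nu> lam F" C \<gamma>
  proof unfold_locales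
    show "solves \<nu> lam F succ g v (\<lambda>t. lattice_cocycle \<nu> lam F t v g)" if "g \<in> shift_hull f" for v g
      by (rule lattice_cocycle_solves[OF subsetD[OF hull that]])
  qed (simp_all add: near_shift_succ hull \<gamma>(1))
  interpret lat: orbit_cocycle UNIV "shift_hull f" "lattice_cocycle \<nu> lam F" f "absorbing C \<gamma> \<inter> UNIV"
    by (rule lat.orbit_cocycle) (rule shift_in_hull[OF assms(7)])
  have app: "solution_cocycle \<nu> lam F (cycle n) (coord_space n) (shift_hull (trunc n \<circ> f)) (approx_cocycle \<nu> lam F n) C \<gamma>" for n
  proof unfold_locales
    show "0 \<in> coord_space n" by (simp add: coord_space_def)
    fix v g t assume v: "v \<in> coord_space n" and g: "g \<in> shift_hull (trunc n \<circ> f)"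
    show "solves \<nu> lam F (cycle n) g v (\<lambda>t. approx_cocycle \<nu> lam F n t v g)"
      by (rule approx_cocycle_solves(1)[OF subsetD[OF hull_n g] hull_n'[OF g] v])
    show "approx_cocycle \<nu> lam F n t v g \<in> coord_space n" if "0 \<le> t"
      by (rule approx_cocycle_solves(2)[OF subsetD[OF hull_n g] hull_n'[OF g] v that])
  qed (rule near_shift_cycle closed_coord_space trunc_coord_space hull_n \<gamma>(1) | assumption)+
  have app_orbit: "orbit_cocycle (coord_space n) (shift_hull (trunc n \<circ> f)) (approx_cocycle \<nu> lam F n)
      (trunc n \<circ> f) (absorbing C \<gamma> \<inter> coord_space n)" for n
    by (rule solution_cocycle.orbit_cocycle[OF app]) (rule shift_in_hull[OF cont_fn])

  show ?thesis
  proof (rule ennreal_tendsto_0I)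
    fix \<epsilon> :: real assume "0 < \<epsilon>"
    then have e2: "0 < \<epsilon> / 2" by simp
    have "\<exists>T0. \<forall>T\<ge>T0. \<forall>b\<in>absorbing C \<gamma>. \<exists>a\<in>lattice_attractor \<nu> lam F f f.
        dist (lattice_cocycle \<nu> lam F T b (shift (- T) f)) a < \<epsilon> / 2"
      unfolding lattice_attractor_def
      by (rule lat.levinson_center_attracts_pullback[OF compact_absorbing[OF \<gamma>(1)] subset_UNIV e2])
    then obtain T0 where T0: "\<And>T b. T \<ge> T0 \<Longrightarrow> b \<in> absorbing C \<gamma> \<Longrightarrow>
        \<exists>a\<in>lattice_attractor \<nu> lam F f f. dist (lattice_cocycle \<nu> lam F T b (shift (- T) f)) a < \<epsilon> / 2"
      by metis
    \<comment> \<open>The time \<open>T\<close> is fixed before \<open>n\<close>: closeness of the two cocycles is controlled only on bounded time intervals.\<close>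
    define T where "T = max 0 T0"
    have T: "0 \<le> T" "T0 \<le> T" by (auto simp: T_def)
    obtain n0 where n0: "\<forall>n\<ge>n0. \<forall>b\<in>absorbing C \<gamma>. \<forall>g\<in>forcing_class C \<gamma>. \<forall>u w.
        solves \<nu> lam F succ g b u \<longrightarrow> solves \<nu> lam F (cycle n) (trunc n \<circ> g) b w \<longrightarrow> dist (w T) (u T) < \<epsilon> / 2"
      using periodic_approximation_converges[OF \<gamma>(1) e2 T(1)] ..
    have "hausdorff_semidist (approx_attractor \<nu> lam F n (trunc n \<circ> f) (trunc n \<circ> f))
        (lattice_attractor \<nu> lam F f f) \<le> ennreal \<epsilon>" if "n \<ge> n0" for n
    proof (rule hausdorff_semidist_leI)
      fix a assume "a \<in> approx_attractor \<nu> lam F n (trunc n \<circ> f) (trunc n \<circ> f)"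
      then have "\<exists>b\<in>absorbing C \<gamma> \<inter> coord_space n.
          a = approx_cocycle \<nu> lam F n T b (shift (- T) (trunc n \<circ> f))"
        unfolding approx_attractor_def
        by (rule orbit_cocycle.levinson_center_pullback[OF app_orbit _ T(1)])
      then obtain b where b: "b \<in> absorbing C \<gamma>" "b \<in> coord_space n"
        and a: "a = approx_cocycle \<nu> lam F n T b (shift (- T) (trunc n \<circ> f))"
        by blast
      let ?g = "shift (- T) f"
      have g: "?g \<in> shift_hull f" by (rule shift_in_hull[OF assms(7)])
      have sh: "shift (- T) (trunc n \<circ> f) = trunc n \<circ> ?g" by (simp add: shift_def o_def)
      have "shift (- T) (trunc n \<circ> f) \<in> shift_hull (trunc n \<circ> f)" by (rule shift_in_hull[OF cont_fn])
      from solution_cocycle.sol[OF app b(2) this]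
      have "solves \<nu> lam F (cycle n) (trunc n \<circ> ?g) b (\<lambda>t. approx_cocycle \<nu> lam F n t b (trunc n \<circ> ?g))"
        by (simp only: sh)
      from n0[rule_format, OF that b(1) subsetD[OF hull g] lat.sol[OF UNIV_I g] this]
      have 1: "dist a (lattice_cocycle \<nu> lam F T b ?g) < \<epsilon> / 2" by (simp only: a sh)
      obtain a' where "a' \<in> lattice_attractor \<nu> lam F f f" "dist (lattice_cocycle \<nu> lam F T b ?g) a' < \<epsilon> / 2"
        using T0[OF T(2) b(1)] by blast
      then show "\<exists>a'\<in>lattice_attractor \<nu> lam F f f. dist a a' \<le> \<epsilon>"
        using 1 dist_triangle[of a a' "lattice_cocycle \<nu> lam F T b ?g"]
        by (intro bexI[of _ a']) linarith+
    qed
    then show "\<forall>\<^sub>F n in sequentially. hausdorff_semidist (approx_attractor \<nu> lam F n (trunc n \<circ> f) (trunc n \<circ> f))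
        (lattice_attractor \<nu> lam F f f) \<le> ennreal \<epsilon>"
      unfolding eventually_sequentially by blast
  qed
qed

end
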